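(* Let $X$ be a downward skip-free continuous-time Markov chain on $\mathbb{N}$ satisfying the standing assumptions of the context, and suppose $\mathbb{P}_x[\tau_0<\infty]=1$ for all $x\ge0$. Then a quasi-stationary distribution of $X$ exists if and only if $\lambda_0>0$.
   Context: $\mathbb{N}=\{0,1,2,\dots\}$. $(\{X_t\}_{t\ge0},\{\mathbb{P}_x\}_{x\in\mathbb{N}})$ is a continuous-time Markov chain on $\mathbb{N}$ with càdlàg paths, whose $Q$-matrix $Q=(Q(x,y))_{x,y\ge0}$ is conservative ($\sum_{y}Q(x,y)=0$ for all $x$), killed at its explosion time $\lim_{z\to\infty}\tau_{[z,\infty)\cap\mathbb{N}}$. For $A\subset\mathbb{N}$, $\tau_A:=\inf\{t>0: X_t\in A\}$ (with $\inf\emptyset=\infty$), $\tau_x:=\tau_{\{x\}}$; $\mathbb{P}_\nu:=\sum_y\nu(y)\mathbb{P}_y$. Standing assumptions: $X$ is downward skip-free, i.e. $Q(x,y)=0$ for $0\le y\le x-2$; $X$ is irreducible on $\mathbb{N}\setminus\{0\}$: $\mathbb{P}_x[\tau_y<\infty]>0$ for $x\ge1$, $y\ge0$; $X$ is regular on $\mathbb{N}\setminus\{0\}$: $\mathbb{P}_x[\tau_{\mathbb{N}\setminus\{x\}}>0]=1$ for $x\ge1$; and $0$ is a trap: $\mathbb{P}_0[X_t=0]=1$ for all $t$. Decay parameter: $\lambda_0:=\sup\{\lambda\ge0:\mathbb{E}_x[e^{\lambda\tau_0}]<\infty\text{ for some }x\ge1\}$. A probability distribution $\nu$ on $\mathbb{N}$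 is a quasi-stationary distribution if $\nu(y)=\mathbb{P}_\nu[X_t=y\mid\tau_0>t]$ for every $y\ge0$, $t\ge0$. *)

theory Defs
  imports "HOL-Probability.Probability"
begin

text \<open>
  A process on the state space \<open>\<nat>\<close> with killing is a function \<open>X :: real \<Rightarrow> 'a \<Rightarrow> nat option\<close>,
  used at times \<open>t \<ge> 0\<close> only; \<open>X t \<omega> = Some x\<close> means that the process is in state \<open>x\<close>
  at time \<open>t\<close>, and \<open>X t \<omega> = None\<close> that it has been killed by time \<open>t\<close>.
\<close>

definition hitting_time :: "(real \<Rightarrow> 'a \<Rightarrow> nat option) \<Rightarrow> nat set \<Rightarrow> 'a \<Rightarrow> ereal" where
  "hitting_time X A \<omega> = Inf (ereal ` {t. t > 0 \<and> X t \<omega> \<in> Some ` A})"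

definition explosion_time :: "(real \<Rightarrow> 'a \<Rightarrow> nat option) \<Rightarrow> 'a \<Rightarrow> ereal" where
  "explosion_time X \<omega> = lim (\<lambda>z. hitting_time X {z..} \<omega>)"

lemma explosion_time_tendsto:
  "(\<lambda>z. hitting_time X {z..} \<omega>) \<longlonglongrightarrow> explosion_time X \<omega>"
  and explosion_time_eq_SUP: "explosion_time X \<omega> = (SUP z. hitting_time X {z..} \<omega>)"
proof -
  have "incseq (\<lambda>z. hitting_time X {z..} \<omega>)"
    unfolding hitting_time_def by (intro monoI Inf_superset_mono image_mono) auto
  then have *: "(\<lambda>z. hitting_time X {z..} \<omega>) \<longlonglongrightarrow> (SUP z. hitting_time X {z..} \<omega>)"
    by (rule LIMSEQ_SUP)
  then show "explosion_time X \<omega> = (SUP z. hitting_time X {z..} \<omega>)"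
    unfolding explosion_time_def by (rule limI)
  with * show "(\<lambda>z. hitting_time X {z..} \<omega>) \<longlonglongrightarrow> explosion_time X \<omega>"
    by simp
qed

text \<open>The \<open>\<sigma>\<close>-algebra generated by the process up to time \<open>s\<close>.\<close>

definition past_events :: "'a measure \<Rightarrow> (real \<Rightarrow> 'a \<Rightarrow> nat option) \<Rightarrow> real \<Rightarrow> 'a set set" where
  "past_events M X s =
     sigma_sets (space M) {X u -` {a} \<inter> space M | u a. 0 \<le> u \<and> u \<le> s}"

text \<open>
  The measure \<open>M\<close> only serves to provide the \<open>\<sigma>\<close>-algebra on which all the laws \<open>P x\<close> live.
  As \<open>\<nat>\<close> is discrete, right-continuity at \<open>t\<close> means that the path is constant on some
  \<open>[t, t + \<epsilon>)\<close>, and existence of a left limit in \<open>\<nat>\<close> means that it is constant on some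
  \<open>(t - \<epsilon>, t)\<close>. Both are required strictly before the explosion time only, which is when
  the process is alive (axiom \<open>killed\<close>). The Markov property is
  \<open>P x (X (s + t) = y | past up to s) = P (X s) (X t = y)\<close> on the event that the process is
  alive at time \<open>s\<close>.
\<close>

locale ctmc =
  fixes M :: "'a measure"
    and X :: "real \<Rightarrow> 'a \<Rightarrow> nat option"
    and P :: "nat \<Rightarrow> 'a measure"
    and Q :: "nat \<Rightarrow> nat \<Rightarrow> real"
  assumes prob_space_P: "\<And>x. prob_space (P x)"
    and sets_P: "\<And>x. sets (P x) = sets M"
    and measurable_X: "\<And>t. 0 \<le> t \<Longrightarrow> X t \<in> M \<rightarrow>\<^sub>M count_space UNIV"
    and initial: "\<And>x. \<P>(\<omega> in P x. X 0 \<omega> = Some x) = 1"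
    and markov: "\<And>x y z s t A. 0 \<le> s \<Longrightarrow> 0 \<le> t \<Longrightarrow> A \<in> past_events M X s \<Longrightarrow>
       \<P>(\<omega> in P x. \<omega> \<in> A \<and> X s \<omega> = Some z \<and> X (s + t) \<omega> = Some y) =
       \<P>(\<omega> in P x. \<omega> \<in> A \<and> X s \<omega> = Some z) * \<P>(\<omega> in P z. X t \<omega> = Some y)"
    and killed: "\<And>\<omega> t. \<omega> \<in> space M \<Longrightarrow> 0 \<le> t \<Longrightarrow>
       X t \<omega> = None \<longleftrightarrow> explosion_time X \<omega> \<le> ereal t"
    and right_continuous: "\<And>\<omega> t. \<omega> \<in> space M \<Longrightarrow> 0 \<le> t \<Longrightarrow> ereal t < explosion_time X \<omega> \<Longrightarrow>
       \<forall>\<^sub>F u in at_right t. X u \<omega> = X t \<omega>"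
    and left_limits: "\<And>\<omega> t. \<omega> \<in> space M \<Longrightarrow> 0 < t \<Longrightarrow> ereal t < explosion_time X \<omega> \<Longrightarrow>
       \<exists>y. \<forall>\<^sub>F u in at_left t. X u \<omega> = Some y"
    and Q_matrix: "\<And>x y.
       ((\<lambda>t. (\<P>(\<omega> in P x. X t \<omega> = Some y) - (if x = y then 1 else 0)) / t) \<longlongrightarrow> Q x y)
         (at_right 0)"
    and conservative: "\<And>x. (Q x has_sum 0) UNIV"

locale downward_skip_free_chain = ctmc +
  assumes skip_free: "\<And>x y. y + 2 \<le> x \<Longrightarrow> Q x y = 0"
    and irreducible: "\<And>x y. 1 \<le> x \<Longrightarrow> \<P>(\<omega> in P x. hitting_time X {y} \<omega> < \<infinity>) > 0"
    and regular: "\<And>x. 1 \<le> x \<Longrightarrow> \<P>(\<omega> in P x. hitting_time X (- {x}) \<omega> > 0) = 1"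
    and trap: "\<And>t. 0 \<le> t \<Longrightarrow> \<P>(\<omega> in P 0. X t \<omega> = Some 0) = 1"

definition ext_exp :: "ereal \<Rightarrow> ennreal" where
  "ext_exp t = (case t of ereal r \<Rightarrow> ennreal (exp r) | PInfty \<Rightarrow> \<infinity> | MInfty \<Rightarrow> 0)"

text \<open>
  The supremum is taken in the extended reals, where \<open>0 * \<infinity> = 0\<close>; thus \<open>0\<close> belongs to the set.
\<close>

definition decay_parameter :: "(real \<Rightarrow> 'a \<Rightarrow> nat option) \<Rightarrow> (nat \<Rightarrow> 'a measure) \<Rightarrow> ereal" where
  "decay_parameter X P = Sup (ereal ` {l. 0 \<le> l \<and>
     (\<exists>x\<ge>1. (\<integral>\<^sup>+ \<omega>. ext_exp (ereal l * hitting_time X {0} \<omega>) \<partial>P x) < \<infinity>)})"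

definition mixture :: "(nat \<Rightarrow> 'a measure) \<Rightarrow> nat pmf \<Rightarrow> 'a measure" where
  "mixture P \<nu> = measure_pmf \<nu> \<bind> P"

lemma (in ctmc) sets_mixture: "sets (mixture P \<nu>) = sets M"
  unfolding mixture_def by (rule sets_bind) (simp_all add: sets_P)

lemma (in ctmc) mixture_sums:
  assumes A: "A \<in> sets M"
  shows "(\<lambda>y. pmf \<nu> y * measure (P y) A) sums measure (mixture P \<nu>) A"
proof -
  have bnd: "0 \<le> measure (P y) A" "measure (P y) A \<le> 1" for y
    using prob_space.prob_le_1[OF prob_space_P] by auto
  have "summable (pmf \<nu>)"
    using integrable_pmf[of UNIV \<nu>] by (simp add: integrable_count_space_nat_iff)
  then have sm: "summable (\<lambda>y. pmf \<nu> y * measure (P y) A)"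
    by (rule summable_comparison_test'[where N = 0]) (use bnd in \<open>auto simp: mult_left_le\<close>)
  have P: "P \<in> measure_pmf \<nu> \<rightarrow>\<^sub>M subprob_algebra M"
    by (auto simp: space_subprob_algebra sets_P prob_space_imp_subprob_space prob_space_P)
  have "emeasure (mixture P \<nu>) A = (\<integral>\<^sup>+ y. emeasure (P y) A \<partial>measure_pmf \<nu>)"
    unfolding mixture_def by (rule emeasure_bind[OF _ P A]) simp
  also have "\<dots> = (\<integral>\<^sup>+ y. ennreal (pmf \<nu> y) * emeasure (P y) A \<partial>count_space UNIV)"
    by (rule nn_integral_measure_pmf)
  also have "\<dots> = (\<Sum>y. ennreal (pmf \<nu> y) * emeasure (P y) A)"
    by (rule nn_integral_count_space_nat)
  also have "\<dots> = (\<Sum>y. ennreal (pmf \<nu> y * measure (P y) A))"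
    using prob_space.finite_measure[OF prob_space_P]
    by (simp add: finite_measure.emeasure_eq_measure ennreal_mult)
  also have "\<dots> = ennreal (\<Sum>y. pmf \<nu> y * measure (P y) A)" (is "_ = ennreal ?s")
    using sm by (intro suminf_ennreal2) auto
  finally have "measure (mixture P \<nu>) A = ?s"
    using sm by (simp add: measure_def suminf_nonneg)
  with sm show ?thesis
    by (simp add: sums_iff)
qed

text \<open>
  The first conjunct only makes the conditional probability well-defined; division by zero would
  force \<open>pmf \<nu> y = 0\<close> for all \<open>y\<close> otherwise, so it is in fact implied by the second.
\<close>

definition quasi_stationary ::
  "(real \<Rightarrow> 'a \<Rightarrow> nat option) \<Rightarrow> (nat \<Rightarrow> 'a measure) \<Rightarrow> nat pmf \<Rightarrow> bool" where
  "quasi_stationary X P \<nu> \<longleftrightarrow>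
     (\<forall>t\<ge>0. \<P>(\<omega> in mixture P \<nu>. hitting_time X {0} \<omega> > ereal t) > 0) \<and>
     (\<forall>y. \<forall>t\<ge>0. pmf \<nu> y =
        \<P>(\<omega> in mixture P \<nu>. X t \<omega> = Some y \<bar> hitting_time X {0} \<omega> > ereal t))"

end

theory Submission
  imports Defs "HOL-Library.Diagonal_Subsequence"
begin

text \<open>
  Since \<open>0\<close> is hit almost surely, the chain is never killed, and everything is expressed by the laws
  \<open>K t x\<close> of \<open>X t\<close> under \<open>P x\<close>. If \<open>\<nu>\<close> is quasi-stationary, then \<open>t \<mapsto> P\<^sub>\<nu> (\<tau>\<^sub>0 > t)\<close> is multiplicative
  and tends to \<open>0\<close>, so it decays exponentially, and so does \<open>P\<^sub>y (\<tau>\<^sub>0 > t)\<close> whenever \<open>\<nu> y > 0\<close>.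

  Conversely, let \<open>\<nu>\<^sub>k D\<close> be proportional to \<open>\<integral>\<^sub>0\<^sup>\<infinity> exp (l\<^sub>k t) P\<^sub>n (X\<^sub>t \<in> D) dt\<close> for \<open>D \<subseteq> {1,2,...}\<close>, with \<open>n\<close>
  depending on \<open>k\<close>. Shifting time by \<open>s\<close> shows that \<open>\<nu>\<^sub>k\<close> is invariant under \<open>exp (l\<^sub>k s) K s\<close> up to an
  error of order \<open>1 / U\<^sub>k\<close>, where \<open>U\<^sub>k = \<integral>\<^sub>0\<^sup>\<infinity> exp (l\<^sub>k t) P\<^sub>n (\<tau>\<^sub>0 > t) dt\<close>. Hence if \<open>U\<^sub>k \<rightarrow> \<infinity>\<close>, \<open>l\<^sub>k \<rightarrow> L > 0\<close> and the
  \<open>\<nu>\<^sub>k\<close> are tight, every limit point is quasi-stationary. Skip-freeness makes \<open>P\<^sub>n (\<tau>\<^sub>0 > t)\<close>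
  nondecreasing in \<open>n\<close>, which leaves two cases. If its limit is \<open>1\<close> for every \<open>t\<close>, fix
  \<open>l\<^sub>k = l < \<lambda>\<^sub>0\<close> and let \<open>n \<rightarrow> \<infinity>\<close>; tightness follows from \<open>\<integral> P\<^sub>x (\<tau>\<^sub>0 > s) d\<nu>\<^sub>k \<le> exp (- l s)\<close>. Otherwise the
  survival probabilities decay exponentially uniformly in \<open>n\<close>; let \<open>l\<^sub>k\<close> increase to the best uniform rate
  \<open>L\<close>. Then the chain comes down from infinity, so that the laws \<open>K 1 x\<close> are tight uniformly in \<open>x\<close>.
\<close>

section \<open>Probability mass functions and null sequences of events\<close>

text \<open>By Scheffe's lemma, pointwise convergence of the masses to a probability distribution
  already is convergence in L1, so expectations of bounded functions converge.\<close>

lemma expectation_pmf_tendsto: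
  fixes g :: "'a \<Rightarrow> real"
  assumes lim: "\<And>y. (\<lambda>i. pmf (\<nu> i) y) \<longlonglongrightarrow> pmf \<mu> y"
    and g: "\<And>x. \<bar>g x\<bar> \<le> 1"
  shows "(\<lambda>i. measure_pmf.expectation (\<nu> i) g) \<longlonglongrightarrow> measure_pmf.expectation \<mu> g"
proof -
  let ?C = "count_space UNIV :: 'a measure"
  have exp_eq: "measure_pmf.expectation p g = (\<integral>x. pmf p x * g x \<partial>?C)" for p
    by (subst measure_pmf_eq_density, subst integral_density) (auto simp: pmf_nonneg)
  have int: "integrable ?C (\<lambda>x. pmf p x * g x)" for p
    by (rule Bochner_Integration.integrable_bound[OF integrable_pmf[of UNIV p]])
       (auto simp: abs_mult g mult_left_le)
  have "(\<lambda>i. \<integral>\<^sup>+ x. norm (pmf (\<nu> i) x - pmf \<mu> x) \<partial>?C) \<longlonglongrightarrow> 0"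
    by (rule Scheffe_lemma2) (auto simp: lim integrable_pmf nn_integral_pmf)
  moreover have nn: "(\<integral>\<^sup>+ x. norm (pmf (\<nu> i) x - pmf \<mu> x) \<partial>?C) =
      ennreal (\<integral>x. norm (pmf (\<nu> i) x - pmf \<mu> x) \<partial>?C)" for i
    by (rule nn_integral_eq_integral) (auto intro!: integrable_norm integrable_pmf Bochner_Integration.integrable_diff)
  ultimately have lim0: "(\<lambda>i. \<integral>x. norm (pmf (\<nu> i) x - pmf \<mu> x) \<partial>?C) \<longlonglongrightarrow> 0"
    by (simp add: ennreal_tendsto_0_iff)
  have le: "\<bar>measure_pmf.expectation (\<nu> i) g - measure_pmf.expectation \<mu> g\<bar> \<le>
      (\<integral>x. norm (pmf (\<nu> i) x - pmf \<mu> x) \<partial>?C)" for i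
  proof -
    have "measure_pmf.expectation (\<nu> i) g - measure_pmf.expectation \<mu> g =
        (\<integral>x. pmf (\<nu> i) x * g x - pmf \<mu> x * g x \<partial>?C)"
      unfolding exp_eq by (rule Bochner_Integration.integral_diff[symmetric]) (rule int)+
    also have "\<bar>\<dots>\<bar> \<le> (\<integral>x. \<bar>pmf (\<nu> i) x * g x - pmf \<mu> x * g x\<bar> \<partial>?C)"
      by (rule integral_abs_bound)
    also have "\<dots> \<le> (\<integral>x. norm (pmf (\<nu> i) x - pmf \<mu> x) \<partial>?C)"
    proof (rule integral_mono)
      fix x
      have "\<bar>pmf (\<nu> i) x * g x - pmf \<mu> x * g x\<bar> = \<bar>pmf (\<nu> i) x - pmf \<mu> x\<bar> * \<bar>g x\<bar>"
        by (metis abs_mult left_diff_distrib)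
      then show "\<bar>pmf (\<nu> i) x * g x - pmf \<mu> x * g x\<bar> \<le> norm (pmf (\<nu> i) x - pmf \<mu> x)"
        using g[of x] by (simp add: mult_left_le)
    qed (auto intro!: integrable_abs integrable_norm integrable_pmf int Bochner_Integration.integrable_diff)
    finally show ?thesis .
  qed
  show ?thesis
    by (rule LIM_zero_cancel[OF Lim_null_comparison[OF _ lim0]]) (use le in simp)
qed

text \<open>Prokhorov's theorem on a countable discrete space: a diagonal argument yields pointwise
  limits of the masses, and tightness keeps mass from escaping to infinity, so the limits sum to
  1.\<close>

lemma pmf_convergent_subsequence:
  fixes \<nu> :: "nat \<Rightarrow> nat pmf"
  assumes tight: "\<And>e. e > 0 \<Longrightarrow> \<exists>k. \<forall>\<^sub>F i in sequentially. measure (\<nu> i) {k..} \<le> e"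
  obtains r \<mu> where "strict_mono r" "\<And>y. (\<lambda>i. pmf (\<nu> (r i)) y) \<longlonglongrightarrow> pmf \<mu> y"
proof -
  interpret subseqs "\<lambda>y s. convergent (\<lambda>i. pmf (\<nu> (s i)) y)"
  proof
    fix y and s :: "nat \<Rightarrow> nat"
    have "\<forall>k. pmf (\<nu> (s k)) y \<in> {0..1}"
      by (simp add: pmf_le_1)
    from compact_imp_seq_compact[OF compact_Icc, THEN seq_compactE, OF this]
    obtain l r where "strict_mono r" "((\<lambda>k. pmf (\<nu> (s k)) y) \<circ> r) \<longlonglongrightarrow> l"
      .
    then show "\<exists>r. strict_mono r \<and> convergent (\<lambda>i. pmf (\<nu> ((s \<circ> r) i)) y)"
      unfolding convergent_def o_def by blast
  qed
  define f where "f y = lim (\<lambda>i. pmf (\<nu> (diagseq i)) y)" for y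
  have "convergent (\<lambda>i. pmf (\<nu> (diagseq i)) y)" for y
  proof -
    \<comment> \<open>Only from index \<open>Suc y\<close> on is the diagonal sequence known to be a
      subsequence of the extraction made for \<open>y\<close>; the finite initial segment does not
      affect the limit.\<close>
    have "convergent (\<lambda>i. pmf (\<nu> ((diagseq \<circ> (+) (Suc y)) i)) y)"
    proof (rule diagseq_holds)
      fix r s :: "nat \<Rightarrow> nat" and n
      assume "strict_mono r" "convergent (\<lambda>i. pmf (\<nu> (s i)) n)"
      from convergent_subseq_convergent[OF this(2,1)]
      show "convergent (\<lambda>i. pmf (\<nu> ((s \<circ> r) i)) n)" by (simp add: o_def)
    qed
    then have "convergent (\<lambda>i. pmf (\<nu> (diagseq (i + Suc y))) y)"
      by (simp add: o_def add.commute)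
    then show ?thesis by (subst (asm) convergent_ignore_initial_segment)
  qed
  then have f: "(\<lambda>i. pmf (\<nu> (diagseq i)) y) \<longlonglongrightarrow> f y" for y
    unfolding f_def by (simp add: convergent_LIMSEQ_iff)
  have f_nonneg: "0 \<le> f y" for y
    by (rule LIMSEQ_le_const[OF f]) simp
  have sum_le: "sum f {..<k} \<le> 1" for k
  proof (rule LIMSEQ_le_const2[OF tendsto_sum[OF f]])
    show "\<exists>N. \<forall>n\<ge>N. (\<Sum>y<k. pmf (\<nu> (diagseq n)) y) \<le> 1"
      by (auto simp: measure_measure_pmf_finite[OF finite_lessThan, symmetric])
  qed
  have sum_ge: "\<exists>k. 1 - e \<le> sum f {..<k}" if "e > 0" for e
  proof -
    obtain k where "\<forall>\<^sub>F i in sequentially. measure (\<nu> i) {k..} \<le> e"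
      using tight[OF \<open>e > 0\<close>] by blast
    then have ev: "\<forall>\<^sub>F i in sequentially. measure (\<nu> (diagseq i)) {k..} \<le> e"
      using subseq_diagseq by (rule eventually_subseq[rotated])
    have "\<forall>\<^sub>F i in sequentially. 1 - e \<le> (\<Sum>y<k. pmf (\<nu> (diagseq i)) y)"
      using ev
    proof eventually_elim
      case (elim i)
      have "measure (\<nu> (diagseq i)) (UNIV - {k..}) = 1 - measure (\<nu> (diagseq i)) {k..}"
        by (subst measure_pmf.prob_compl[symmetric]) auto
      moreover have "UNIV - {k..} = {..<k}" by auto
      ultimately show ?case
        using elim by (simp add: measure_measure_pmf_finite)
    qed
    from tendsto_lowerbound[OF tendsto_sum[OF f] this] show ?thesis by auto
  qed
  have "f sums 1"
  proof -
    have "(\<lambda>k. sum f {..<k}) \<longlonglongrightarrow> 1"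
    proof (rule order_tendstoI)
      fix a :: real assume "a < 1"
      then obtain k where k: "1 - (1 - a) / 2 \<le> sum f {..<k}"
        using sum_ge[of "(1 - a) / 2"] by auto
      have "a < sum f {..<n}" if "n \<ge> k" for n
      proof -
        have "sum f {..<k} \<le> sum f {..<n}"
          using f_nonneg that by (intro sum_mono2) auto
        then show ?thesis using k \<open>a < 1\<close> by (simp add: field_simps)
      qed
      then show "\<forall>\<^sub>F n in sequentially. a < sum f {..<n}"
        unfolding eventually_sequentially by blast
    next
      fix a :: real assume "1 < a"
      then show "\<forall>\<^sub>F n in sequentially. sum f {..<n} < a"
        using le_less_trans[OF sum_le] by (intro always_eventually allI) blast
    qed
    then show ?thesis by (simp add: sums_def)
  qed
  then have "(\<integral>\<^sup>+ x. ennreal (f x) \<partial>count_space UNIV) = 1"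
    using f_nonneg by (simp add: nn_integral_count_space_nat suminf_ennreal2 sums_iff)
  then have "pmf (embed_pmf f) y = f y" for y
    using f_nonneg by (intro pmf_embed_pmf) auto
  with f subseq_diagseq show ?thesis
    by (intro that[of diagseq "embed_pmf f"]) auto
qed

lemma pmf_mult_le_expectation:
  fixes f :: "'a \<Rightarrow> real"
  assumes "\<And>x. 0 \<le> f x" "\<And>x. f x \<le> 1"
  shows "pmf p a * f a \<le> measure_pmf.expectation p f"
proof -
  have "pmf p a * f a = measure_pmf.expectation p (\<lambda>x. f a * indicator {a} x)"
    by (simp add: measure_pmf_single)
  also have "\<dots> \<le> measure_pmf.expectation p f"
    using assms by (intro integral_mono measure_pmf.integrable_const_bound[where B = 1])
      (auto split: split_indicator)
  finally show ?thesis .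
qed

lemma expectation_pmf_nat_sums:
  fixes g :: "nat \<Rightarrow> real"
  assumes "\<And>x. \<bar>g x\<bar> \<le> 1"
  shows "(\<lambda>x. pmf p x * g x) sums measure_pmf.expectation p g"
proof -
  have "integrable (count_space UNIV) (\<lambda>x. pmf p x * g x)"
    by (rule Bochner_Integration.integrable_bound[OF integrable_pmf[of UNIV p]])
       (auto simp: abs_mult assms mult_left_le)
  then have "(\<lambda>x. pmf p x * g x) sums (\<integral>x. pmf p x * g x \<partial>count_space UNIV)"
    by (rule sums_integral_count_space_nat)
  also have "(\<integral>x. pmf p x * g x \<partial>count_space UNIV) = measure_pmf.expectation p g"
    by (subst measure_pmf_eq_density, subst integral_density) (auto simp: pmf_nonneg)
  finally show ?thesis .
qed

lemma pmf_eq_1_imp_return_pmf: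
  assumes "pmf p x = 1"
  shows "p = return_pmf x"
proof -
  have "AE y in p. y \<in> {x}"
    by (rule measure_pmf.AE_prob_1) (simp add: measure_pmf_single assms)
  then show ?thesis
    by (simp add: AE_measure_pmf_iff subset_iff set_pmf_subset_singleton[symmetric])
qed

lemma (in prob_space) prob_tendsto_0:
  assumes [measurable]: "\<And>N. A N \<in> events"
    and ae: "AE \<omega> in M. \<forall>\<^sub>F N in sequentially. \<omega> \<notin> A N"
  shows "(\<lambda>N. prob (A N)) \<longlonglongrightarrow> 0"
proof -
  have "(\<lambda>N. \<integral>\<omega>. indicator (A N) \<omega> \<partial>M) \<longlonglongrightarrow> (\<integral>\<omega>. (0::real) \<partial>M)"
  proof (rule integral_dominated_convergence)
    show "AE \<omega> in M. (\<lambda>N. indicator (A N) \<omega> :: real) \<longlonglongrightarrow> 0"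
      using ae
    proof eventually_elim
      case (elim \<omega>)
      then show ?case
        by (intro tendsto_eventually) (auto elim!: eventually_mono)
    qed
    show "integrable M (\<lambda>_. 1 :: real)" by simp
    show "AE \<omega> in M. norm (indicator (A N) \<omega> :: real) \<le> 1" for N
      by (auto split: split_indicator)
  qed simp_all
  then show ?thesis by simp
qed

text \<open>Fatou's inequality for the lower limit of events. It serves to exclude jumps that would
  be visible on every fine grid.\<close>

lemma (in prob_space) AE_not_eventually:
  assumes [measurable]: "\<And>N. A N \<in> events" and lim: "(\<lambda>N. prob (A N)) \<longlonglongrightarrow> 0"
  shows "AE \<omega> in M. \<not> (\<forall>\<^sub>F N in sequentially. \<omega> \<in> A N)"
proof -
  have "AE \<omega> in M. \<not> (\<forall>N\<ge>k. \<omega> \<in> A N)" for k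
  proof -
    have "prob (\<Inter>N\<in>{k..}. A N) \<le> 0"
    proof (rule LIMSEQ_le_const[OF lim], intro exI[of _ k] allI impI)
      fix N assume "k \<le> N"
      then show "prob (\<Inter>N\<in>{k..}. A N) \<le> prob (A N)"
        by (intro finite_measure_mono) auto
    qed
    then have "AE \<omega> in M. \<omega> \<notin> (\<Inter>N\<in>{k..}. A N)"
      by (subst prob_eq_0[symmetric]) (auto simp: measure_le_0_iff)
    then show ?thesis by eventually_elim auto
  qed
  then have "AE \<omega> in M. \<forall>k. \<not> (\<forall>N\<ge>k. \<omega> \<in> A N)"
    by (simp add: AE_all_countable)
  then show ?thesis
    by eventually_elim (auto simp: eventually_sequentially)
qed

section \<open>Semigroups of probability mass functions absorbed at 0\<close>

text \<open>This isolates the analytic part of the argument. Path properties enter it only as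
  hypotheses: monotonicity of survival in the starting point, irreducibility, tightness at time 1,
  and convergence of survival to 0.\<close>

locale absorbed_semigroup =
  fixes K :: "real \<Rightarrow> nat \<Rightarrow> nat pmf"
  assumes K_0: "K 0 x = return_pmf x"
    and K_add: "0 \<le> s \<Longrightarrow> 0 \<le> t \<Longrightarrow> K (s + t) x = bind_pmf (K s x) (K t)"
    and K_absorbing: "0 \<le> t \<Longrightarrow> K t 0 = return_pmf 0"
    and K_cont: "((\<lambda>t. pmf (K t x) x) \<longlongrightarrow> 1) (at_right 0)"
begin

section \<open>Regularity of the semigroup in time\<close>

lemma pmf_K_diff_le:
  assumes "0 \<le> t" "0 \<le> h"
  shows "\<bar>pmf (K (h + t) x) y - pmf (K t x) y\<bar> \<le> 1 - pmf (K h x) x"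
proof -
  have eq: "pmf (K (h + t) x) y = measure_pmf.expectation (K h x) (\<lambda>z. pmf (K t z) y)"
    using assms by (simp add: K_add pmf_bind)
  \<comment> \<open>Keep only the event of being in \<open>x\<close> at time \<open>h\<close>, once
    for ending in \<open>y\<close> and once for the complement. The two lower bounds trap the
    difference from both sides.\<close>
  have "pmf (K h x) x * pmf (K t x) y \<le> pmf (K (h + t) x) y"
    unfolding eq by (rule pmf_mult_le_expectation) (auto simp: pmf_le_1)
  moreover have "pmf (K h x) x * (1 - pmf (K t x) y) \<le> 1 - pmf (K (h + t) x) y"
  proof -
    have "pmf (K h x) x * (1 - pmf (K t x) y) \<le>
        measure_pmf.expectation (K h x) (\<lambda>z. 1 - pmf (K t z) y)"
      by (rule pmf_mult_le_expectation) (auto simp: pmf_le_1)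
    also have "\<dots> = 1 - pmf (K (h + t) x) y"
      unfolding eq
      by (subst Bochner_Integration.integral_diff)
        (auto intro!: measure_pmf.integrable_const_bound[where B = 1] simp: pmf_le_1)
    finally show ?thesis .
  qed
  moreover have "(1 - pmf (K h x) x) * pmf (K t x) y \<le> 1 - pmf (K h x) x"
    "(1 - pmf (K h x) x) * (1 - pmf (K t x) y) \<le> 1 - pmf (K h x) x"
    by (auto intro!: mult_left_le simp: pmf_le_1)
  ultimately show ?thesis
    by (simp add: algebra_simps abs_le_iff)
qed

text \<open>The modulus of continuity \<open>1 - pmf (K h x) x\<close> depends neither on the time
  nor on \<open>y\<close>, so continuity at time 0 spreads to all times. It provides the
  measurability needed to integrate over time.\<close>

lemma continuous_on_pmf_K: "continuous_on {0..} (\<lambda>t. pmf (K t x) y)"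
  unfolding continuous_on_iff
proof (intro ballI allI impI)
  fix t e :: real assume "t \<in> {0..}" "0 < e"
  have "\<forall>\<^sub>F h in at_right 0. 1 - e < pmf (K h x) x"
    using K_cont \<open>0 < e\<close> by (intro order_tendstoD) auto
  then obtain d where d: "d > 0" "\<And>h. 0 < h \<Longrightarrow> h < d \<Longrightarrow> 1 - e < pmf (K h x) x"
    unfolding eventually_at_right by (auto simp: eventually_at_right_field)
  have d': "1 - pmf (K h x) x < e" if "0 \<le> h" "h < d" for h
    using that \<open>0 < e\<close> d(2)[of h] by (cases "0 < h") (auto simp: K_0 not_less)
  have "dist (pmf (K s x) y) (pmf (K t x) y) < e" if "s \<ge> 0" "dist s t < d" for s
  proof (cases "s \<le> t")
    case True
    with pmf_K_diff_le[of s "t - s" x y] d'[of "t - s"] that show ?thesis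
      by (simp add: dist_real_def abs_minus_commute)
  next
    case False
    with pmf_K_diff_le[of t "s - t" x y] d'[of "s - t"] that \<open>t \<in> {0..}\<close> show ?thesis
      by (simp add: dist_real_def)
  qed
  with \<open>d > 0\<close> show "\<exists>d>0. \<forall>s\<in>{0..}. dist s t < d \<longrightarrow> dist (pmf (K s x) y) (pmf (K t x) y) < e"
    by auto
qed

lemma borel_measurable_pmf_K:
  "(\<lambda>t. ennreal (pmf (K t x) y) * indicator {0..} t) \<in> borel_measurable borel"
proof -
  have "(\<lambda>t. indicator {0..} t *\<^sub>R pmf (K t x) y) \<in> borel_measurable borel"
    by (intro borel_measurable_continuous_on_indicator continuous_on_pmf_K) simp
  then have "(\<lambda>t. ennreal (indicator {0..} t *\<^sub>R pmf (K t x) y)) \<in> borel_measurable borel"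
    by measurable
  also have "(\<lambda>t. ennreal (indicator {0..} t *\<^sub>R pmf (K t x) y)) =
      (\<lambda>t. ennreal (pmf (K t x) y) * indicator {0..} t)"
    by (auto simp: fun_eq_iff split: split_indicator)
  finally show ?thesis .
qed

lemma nn_integral_K:
  "(\<integral>\<^sup>+x. g x \<partial>K t n) * indicator {0..} t =
    (\<Sum>y. ennreal (pmf (K t n) y) * indicator {0..} t * g y)"
  by (auto simp: nn_integral_measure_pmf nn_integral_count_space_nat split: split_indicator)

lemma borel_measurable_nn_integral_K:
  "(\<lambda>t. (\<integral>\<^sup>+x. g x \<partial>K t n) * indicator {0..} t) \<in> borel_measurable borel"
  unfolding nn_integral_K using borel_measurable_pmf_K by measurable

lemma borel_measurable_exp_times:
  "f \<in> borel_measurable borel \<Longrightarrow>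
    (\<lambda>t::real. ennreal (exp (l * t)) * f t) \<in> borel_measurable borel"
  by measurable

section \<open>The resolvent at the parameter \<open>- l\<close>, and its normalisation to a
  distribution\<close>

definition potential :: "real \<Rightarrow> nat \<Rightarrow> (nat \<Rightarrow> ennreal) \<Rightarrow> ennreal" where
  "potential l n g =
     (\<integral>\<^sup>+t. ennreal (exp (l * t)) * ((\<integral>\<^sup>+x. g x \<partial>K t n) * indicator {0..} t) \<partial>lborel)"

text \<open>Tonelli: the potential is integration against the Green measure with point masses
  \<open>potential l n (indicator {y})\<close>.\<close>

lemma potential_eq_suminf:
  "potential l n g = (\<Sum>y. potential l n (indicator {y}) * g y)"
proof -
  have "potential l n (indicator {y}) * g y = (\<integral>\<^sup>+t. ennreal (exp (l * t)) *
      (ennreal (pmf (K t n) y) * indicator {0..} t * g y) \<partial>lborel)" for y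
  proof -
    have "potential l n (indicator {y}) * g y = (\<integral>\<^sup>+t. ennreal (exp (l * t)) *
        (ennreal (pmf (K t n) y) * indicator {0..} t) \<partial>lborel) * g y"
      by (simp add: potential_def emeasure_pmf_single)
    also have "\<dots> = (\<integral>\<^sup>+t. ennreal (exp (l * t)) *
        (ennreal (pmf (K t n) y) * indicator {0..} t) * g y \<partial>lborel)"
      using borel_measurable_pmf_K
      by (intro nn_integral_multc[symmetric]) (simp add: borel_measurable_exp_times)
    finally show ?thesis by (simp add: mult_ac)
  qed
  moreover have "potential l n g = (\<integral>\<^sup>+t. (\<Sum>y. ennreal (exp (l * t)) *
      (ennreal (pmf (K t n) y) * indicator {0..} t * g y)) \<partial>lborel)"
    unfolding potential_def nn_integral_K by simp
  moreover have "\<dots> = (\<Sum>y. \<integral>\<^sup>+t. ennreal (exp (l * t)) *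
      (ennreal (pmf (K t n) y) * indicator {0..} t * g y) \<partial>lborel)"
  proof (rule nn_integral_suminf)
    fix y
    show "(\<lambda>t. ennreal (exp (l * t)) * (ennreal (pmf (K t n) y) * indicator {0..} t * g y)) \<in>
        borel_measurable lborel"
      using borel_measurable_times_ennreal[OF borel_measurable_pmf_K, of "\<lambda>_. g y"]
      by (simp add: borel_measurable_exp_times)
  qed
  ultimately show ?thesis by simp
qed

text \<open>Cut the time integral at \<open>s\<close>, substitute \<open>s + t\<close> in the tail
  and move \<open>K s\<close> onto \<open>g\<close> by the semigroup property. The initial segment
  is the only defect of invariance.\<close>

lemma potential_shift:
  assumes "0 \<le> s"
  shows "potential l n g =
    (\<integral>\<^sup>+t. ennreal (exp (l * t)) * ((\<integral>\<^sup>+x. g x \<partial>K t n) * indicator {0..<s} t) \<partial>lborel) +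
    ennreal (exp (l * s)) * potential l n (\<lambda>x. \<integral>\<^sup>+y. g y \<partial>K s x)"
proof -
  define f where "f t = ennreal (exp (l * t)) * ((\<integral>\<^sup>+x. g x \<partial>K t n) * indicator {0..} t)" for t
  have f [measurable]: "f \<in> borel_measurable borel"
    unfolding f_def using borel_measurable_nn_integral_K[of n g] by measurable
  have "potential l n g = (\<integral>\<^sup>+t. f t * indicator {..<s} t + f t * indicator {s..} t \<partial>lborel)"
    unfolding potential_def f_def[symmetric]
    by (intro nn_integral_cong) (auto split: split_indicator)
  also have "\<dots> = (\<integral>\<^sup>+t. f t * indicator {..<s} t \<partial>lborel) + (\<integral>\<^sup>+t. f t * indicator {s..} t \<partial>lborel)"
    by (rule nn_integral_add) measurable
  also have "(\<integral>\<^sup>+t. f t * indicator {s..} t \<partial>lborel) =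
      (\<integral>\<^sup>+t. f (s + t) * indicator {s..} (s + t) \<partial>lborel)"
    using nn_integral_real_affine[of "\<lambda>t. f t * indicator {s..} t" 1 s] by simp
  also have "\<dots> = (\<integral>\<^sup>+t. ennreal (exp (l * s)) *
      (ennreal (exp (l * t)) * ((\<integral>\<^sup>+x. \<integral>\<^sup>+y. g y \<partial>K s x \<partial>K t n) * indicator {0..} t)) \<partial>lborel)"
  proof (rule nn_integral_cong)
    fix t
    show "f (s + t) * indicator {s..} (s + t) = ennreal (exp (l * s)) *
        (ennreal (exp (l * t)) * ((\<integral>\<^sup>+x. \<integral>\<^sup>+y. g y \<partial>K s x \<partial>K t n) * indicator {0..} t))"
    proof (cases "t \<ge> 0")
      case True
      then have "K (s + t) n = bind_pmf (K t n) (K s)"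
        using K_add[of t s n] assms by (simp add: add.commute)
      with True assms show ?thesis
        by (simp add: f_def distrib_left exp_add ennreal_mult mult.assoc)
    qed simp
  qed
  also have "\<dots> = ennreal (exp (l * s)) * potential l n (\<lambda>x. \<integral>\<^sup>+y. g y \<partial>K s x)"
    unfolding potential_def
    using borel_measurable_nn_integral_K[of n "\<lambda>x. \<integral>\<^sup>+y. g y \<partial>K s x"]
    by (intro nn_integral_cmult) (simp add: borel_measurable_exp_times)
  also have "(\<integral>\<^sup>+t. f t * indicator {..<s} t \<partial>lborel) =
      (\<integral>\<^sup>+t. ennreal (exp (l * t)) * ((\<integral>\<^sup>+x. g x \<partial>K t n) * indicator {0..<s} t) \<partial>lborel)"
    unfolding f_def by (intro nn_integral_cong) (auto split: split_indicator)
  finally show ?thesis .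
qed

lemma potential_initial_le:
  assumes "0 \<le> s" "0 \<le> l" and g: "\<And>x. g x \<le> 1"
  shows "(\<integral>\<^sup>+t. ennreal (exp (l * t)) * ((\<integral>\<^sup>+x. g x \<partial>K t n) * indicator {0..<s} t) \<partial>lborel) \<le>
    ennreal (s * exp (l * s))"
proof -
  have le_1: "(\<integral>\<^sup>+x. g x \<partial>K t n) \<le> 1" for t
  proof -
    have "(\<integral>\<^sup>+x. g x \<partial>K t n) \<le> (\<integral>\<^sup>+x. 1 \<partial>K t n)"
      by (intro nn_integral_mono g)
    then show ?thesis by simp
  qed
  have "(\<integral>\<^sup>+t. ennreal (exp (l * t)) * ((\<integral>\<^sup>+x. g x \<partial>K t n) * indicator {0..<s} t) \<partial>lborel) \<le>
      (\<integral>\<^sup>+t. ennreal (exp (l * s)) * indicator {0..<s} t \<partial>lborel)"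
  proof (rule nn_integral_mono)
    fix t
    have "ennreal (exp (l * t)) * (\<integral>\<^sup>+x. g x \<partial>K t n) \<le> ennreal (exp (l * s)) * 1" if "t < s"
      using that assms le_1 by (intro mult_mono ennreal_leI) (auto intro: mult_left_mono)
    then show "ennreal (exp (l * t)) * ((\<integral>\<^sup>+x. g x \<partial>K t n) * indicator {0..<s} t) \<le>
        ennreal (exp (l * s)) * indicator {0..<s} t"
      by (auto split: split_indicator)
  qed
  also have "\<dots> = ennreal (s * exp (l * s))"
    using assms by (simp add: nn_integral_cmult_indicator ennreal_mult mult.commute)
  finally show ?thesis .
qed

text \<open>As 0 is absorbing, this plays the role of the probability that 0 has not been hit by
  time \<open>t\<close>; \<open>survival_eq\<close> makes the identification for the chain.\<close>

definition survival :: "real \<Rightarrow> nat \<Rightarrow> real" where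
  "survival t x = measure (K t x) {0<..}"

text \<open>\<open>\<nu>\<close> is the Green measure on the positive states divided by its mass
  \<open>u\<close>. The initial segment in \<open>potential_shift\<close> lies between 0 and
  \<open>s * exp (l * s)\<close>, which gives both bounds after division by
  \<open>u\<close>.\<close>

lemma resolvent_distribution:
  assumes l: "0 \<le> l"
    and U: "potential l n (indicator {0<..}) = ennreal u" "0 < u"
  obtains \<nu> where "pmf \<nu> 0 = 0"
    and "\<And>s D. 0 \<le> s \<Longrightarrow> 0 \<notin> D \<Longrightarrow>
      exp (l * s) * measure (bind_pmf \<nu> (K s)) D \<le> measure \<nu> D"
    and "\<And>s D. 0 \<le> s \<Longrightarrow> 0 \<notin> D \<Longrightarrow>
      measure \<nu> D \<le> exp (l * s) * measure (bind_pmf \<nu> (K s)) D + s * exp (l * s) / u"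
proof -
  define G where "G y = potential l n (indicator {y})" for y
  have pot: "potential l n g = (\<Sum>y. G y * g y)" for g
    unfolding G_def by (rule potential_eq_suminf)
  have sumG: "(\<Sum>y. G y * indicator {0<..} y) = ennreal u"
    using U(1) by (simp add: pot[symmetric])
  have G_le: "G y \<le> ennreal u" if "y > 0" for y
    unfolding sumG[symmetric]
    using sum_le_suminf[OF summableI, of "{y}" "\<lambda>y. G y * indicator {0<..} y :: ennreal"] that by auto
  define f where "f y = (if y = 0 then 0 else enn2real (G y) / u)" for y
  have f_nonneg: "0 \<le> f y" for y
    using U(2) by (simp add: f_def)
  have f_eq: "ennreal (f y) * ennreal u = G y * indicator {0<..} y" for y
  proof (cases "y = 0")
    case False
    \<comment> \<open>For \<open>y > 0\<close> the mass \<open>G y\<close> is at most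
      \<open>u\<close>, hence finite, so \<open>enn2real\<close> does not fall back to its default
      value.\<close>
    then have "G y = ennreal (enn2real (G y))"
      using G_le[of y] by (metis ennreal_enn2real ennreal_less_top le_less_trans gr0I)
    with False U(2) show ?thesis
      by (simp add: f_def ennreal_mult[symmetric])
  qed (simp add: f_def)
  have "(\<integral>\<^sup>+y. ennreal (f y) \<partial>count_space UNIV) * ennreal u = ennreal u"
    by (simp add: nn_integral_count_space_nat ennreal_suminf_multc[symmetric] f_eq sumG)
  then have "(\<integral>\<^sup>+y. ennreal (f y) \<partial>count_space UNIV) = 1"
    using U(2)
    by (cases "\<integral>\<^sup>+y. ennreal (f y) \<partial>count_space UNIV" rule: ennreal_cases)
       (auto simp: ennreal_mult[symmetric] ennreal_top_mult)
  then have pmf: "pmf (embed_pmf f) y = f y" for y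
    using f_nonneg by (intro pmf_embed_pmf) auto
  have nn: "(\<integral>\<^sup>+x. g x \<partial>embed_pmf f) * ennreal u = potential l n g" if "g 0 = 0" for g
  proof -
    have "(\<integral>\<^sup>+x. g x \<partial>embed_pmf f) * ennreal u = (\<Sum>y. ennreal (f y) * g y) * ennreal u"
      by (simp add: nn_integral_measure_pmf pmf nn_integral_count_space_nat)
    also have "\<dots> = (\<Sum>y. (ennreal (f y) * ennreal u) * g y)"
      unfolding ennreal_suminf_multc[symmetric] by (intro suminf_cong) (simp add: mult_ac)
    also have "\<dots> = (\<Sum>y. G y * g y)"
      unfolding f_eq using that by (intro suminf_cong) (auto split: split_indicator)
    finally show ?thesis by (simp add: pot)
  qed
  let ?\<nu> = "embed_pmf f"
  have main: "exp (l * s) * measure (bind_pmf ?\<nu> (K s)) D \<le> measure ?\<nu> D \<and>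
      measure ?\<nu> D \<le> exp (l * s) * measure (bind_pmf ?\<nu> (K s)) D + s * exp (l * s) / u"
    if s: "0 \<le> s" and D: "0 \<notin> D" for s D
  proof -
    define I where "I = (\<integral>\<^sup>+t. ennreal (exp (l * t)) *
      ((\<integral>\<^sup>+x. indicator D x \<partial>K t n) * indicator {0..<s} t) \<partial>lborel)"
    have I: "I \<le> ennreal (s * exp (l * s))"
      unfolding I_def using s l by (intro potential_initial_le) (auto split: split_indicator)
    then have "I < \<infinity>" by (simp add: order_le_less_trans)
    then obtain r where r: "I = ennreal r" "0 \<le> r"
      by (cases I) auto
    have r_le: "r \<le> s * exp (l * s)"
      using I r s by (simp add: ennreal_le_iff)
    have 1: "emeasure ?\<nu> D * ennreal u = potential l n (indicator D)"
      using nn[of "indicator D"] D by simp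
    \<comment> \<open>Absorption makes \<open>K s 0\<close> give no mass to \<open>D\<close>, so the
      integrand vanishes at 0 as \<open>nn\<close> requires.\<close>
    have 2: "emeasure (bind_pmf ?\<nu> (K s)) D * ennreal u =
        potential l n (\<lambda>x. \<integral>\<^sup>+y. indicator D y \<partial>K s x)"
      using nn[of "\<lambda>x. emeasure (K s x) D"] s D by (simp add: K_absorbing)
    have "emeasure ?\<nu> D * ennreal u =
        ennreal r + ennreal (exp (l * s)) * (emeasure (bind_pmf ?\<nu> (K s)) D * ennreal u)"
      unfolding 1 2 r(1)[symmetric] I_def by (rule potential_shift[OF s])
    then have "ennreal (measure ?\<nu> D * u) =
        ennreal (r + exp (l * s) * (measure (bind_pmf ?\<nu> (K s)) D * u))"
      using r(2) U(2) by (simp add: measure_pmf.emeasure_eq_measure ennreal_mult[symmetric] ennreal_plus[symmetric]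
        del: ennreal_plus emeasure_bind_pmf)
    then have "measure ?\<nu> D * u = r + exp (l * s) * (measure (bind_pmf ?\<nu> (K s)) D * u)"
      using r(2) U(2) by (subst (asm) ennreal_inj) auto
    then have "measure ?\<nu> D = exp (l * s) * measure (bind_pmf ?\<nu> (K s)) D + r / u"
      using U(2) by (simp add: field_simps)
    with r r_le U(2) show ?thesis
      by (simp add: divide_right_mono)
  qed
  show ?thesis
    by (rule that[of ?\<nu>]) (use main in \<open>auto simp: pmf f_def\<close>)
qed

section \<open>Survival probabilities and exponential rates\<close>

lemma measure_bind_K: "measure (bind_pmf \<nu> (K t)) D = measure_pmf.expectation \<nu> (\<lambda>x. measure (K t x) D)"
proof -
  have "ennreal (measure (bind_pmf \<nu> (K t)) D) = (\<integral>\<^sup>+x. ennreal (measure (K t x) D) \<partial>\<nu>)"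
    by (simp add: measure_pmf.emeasure_eq_measure[symmetric])
  also have "\<dots> = ennreal (measure_pmf.expectation \<nu> (\<lambda>x. measure (K t x) D))"
    by (intro nn_integral_eq_integral measure_pmf.integrable_const_bound[where B = 1]) auto
  finally show ?thesis
    by (subst (asm) ennreal_inj) (auto intro!: Bochner_Integration.integral_nonneg)
qed

lemma survival_nonneg [simp]: "0 \<le> survival t x"
  and survival_le_1 [simp]: "survival t x \<le> 1"
  by (simp_all add: survival_def)

lemma survival_absorbed [simp]: "0 \<le> t \<Longrightarrow> survival t 0 = 0"
  by (simp add: survival_def K_absorbing measure_return_pmf)

lemma integrable_survival: "integrable (measure_pmf p) (survival t)"
  by (rule measure_pmf.integrable_const_bound[where B = 1]) auto

lemma survival_add:
  "0 \<le> s \<Longrightarrow> 0 \<le> t \<Longrightarrow> survival (s + t) x = measure_pmf.expectation (K s x) (survival t)"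
  by (simp add: survival_def[abs_def] K_add measure_bind_K)

text \<open>Condition on the state at time \<open>s\<close>: state 0 contributes nothing, every
  other state at most \<open>a\<close>.\<close>

lemma survival_add_le:
  assumes "0 \<le> s" "0 \<le> t" and a: "\<And>y. survival t y \<le> a"
  shows "survival (s + t) x \<le> a * survival s x"
proof -
  have "survival (s + t) x \<le> measure_pmf.expectation (K s x) (\<lambda>y. a * indicator {0<..} y)"
    unfolding survival_add[OF assms(1,2)]
  proof (rule integral_mono[OF integrable_survival])
    show "integrable (K s x) (\<lambda>y. a * indicator {0<..} y)"
      by (rule measure_pmf.integrable_const_bound[where B = "\<bar>a\<bar>"]) (auto split: split_indicator)
    show "survival t y \<le> a * indicator {0<..} y" for y
      using a[of y] assms by (cases "y = 0") auto
  qed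
  then show ?thesis by (simp add: survival_def)
qed

lemma survival_antimono:
  assumes "0 \<le> s" "s \<le> t"
  shows "survival t x \<le> survival s x"
  using survival_add_le[of s "t - s" 1 x] assms by simp

text \<open>The supremum of survival over all starting points is submultiplicative, so a bound at
  the single time \<open>t\<close> can be iterated over blocks of length \<open>t\<close>. The
  factor \<open>exp (l * t)\<close> pays for the incomplete last block.\<close>

lemma survival_uniform_decay:
  assumes t: "0 < t" and l: "0 \<le> l" and le: "\<And>x. survival t x \<le> exp (- l * t)"
    and u: "0 \<le> u"
  shows "survival u x \<le> exp (l * t) * exp (- l * u)"
proof -
  have pow: "survival (real k * t) x \<le> exp (- l * t) ^ k" for k
  proof (induction k)
    case (Suc k)
    have "survival (real (Suc k) * t) x \<le> exp (- l * t) * survival (real k * t) x"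
      using survival_add_le[of "real k * t" t "exp (- l * t)" x] t le by (simp add: distrib_right add.commute)
    also have "\<dots> \<le> exp (- l * t) * exp (- l * t) ^ k"
      using Suc by (intro mult_left_mono) auto
    finally show ?case by simp
  qed simp
  define k where "k = nat \<lfloor>u / t\<rfloor>"
  have "real k \<le> u / t" "u / t < real k + 1"
    using t u by (auto simp: k_def)
  then have k: "real k * t \<le> u" "u \<le> (real k + 1) * t"
    using t by (auto simp: field_simps)
  have "survival u x \<le> survival (real k * t) x"
    using k t by (intro survival_antimono) auto
  also have "\<dots> \<le> exp (- l * t) ^ k" by (rule pow)
  also have "\<dots> = exp (- l * (real k * t))"
    by (simp add: exp_of_nat_mult[symmetric] mult_ac)
  also have "\<dots> \<le> exp (l * t - l * u)"
    using mult_left_mono[OF k(2) l] by (simp add: algebra_simps)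
  finally show ?thesis by (simp add: exp_add[symmetric])
qed

text \<open>The integrand is at most \<open>c * exp (- (r - l) * t)\<close>, which is integrable
  since \<open>l < r\<close>.\<close>

lemma potential_survival_finite:
  assumes l: "l < r" and le: "\<And>t. 0 \<le> t \<Longrightarrow> survival t n \<le> c * exp (- r * t)"
  shows "potential l n (indicator {0<..}) < \<infinity>"
proof -
  define d where "d = r - l"
  have d: "0 < d" using l by (simp add: d_def)
  have c: "0 \<le> c"
    using order_trans[OF survival_nonneg le[of 0]] by simp
  have "potential l n (indicator {0<..}) =
      (\<integral>\<^sup>+t. ennreal (exp (l * t)) * (ennreal (survival t n) * indicator {0..} t) \<partial>lborel)"
    by (simp add: potential_def survival_def measure_pmf.emeasure_eq_measure)
  also have "\<dots> \<le> (\<integral>\<^sup>+t. ennreal (c * exp (- d * t)) * indicator {0..} t \<partial>lborel)"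
  proof (rule nn_integral_mono)
    fix t
    have "exp (l * t) * survival t n \<le> c * exp (- d * t)" if "0 \<le> t"
    proof -
      have "exp (l * t) * survival t n \<le> exp (l * t) * (c * exp (- r * t))"
        using le[OF that] by (intro mult_left_mono) auto
      also have "\<dots> = c * exp (- d * t)"
        by (simp add: d_def exp_add[symmetric] algebra_simps)
      finally show ?thesis .
    qed
    then show "ennreal (exp (l * t)) * (ennreal (survival t n) * indicator {0..} t) \<le>
        ennreal (c * exp (- d * t)) * indicator {0..} t"
      by (auto simp: ennreal_mult[symmetric] intro!: ennreal_leI split: split_indicator)
  qed
  also have "\<dots> = ennreal (0 - - (c / d) * exp (- d * 0))"
  proof (rule nn_integral_FTC_atLeast)
    show "DERIV (\<lambda>t. - (c / d) * exp (- d * t)) t :> c * exp (- d * t)" for t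
      using d by (auto intro!: derivative_eq_intros)
    have "((\<lambda>t. exp (- d * t)) \<longlongrightarrow> 0) at_top"
      using d by (intro filterlim_compose[OF exp_at_bot] filterlim_tendsto_neg_mult_at_bot[OF tendsto_const _ filterlim_ident]) auto
    then show "((\<lambda>t. - (c / d) * exp (- d * t)) \<longlongrightarrow> 0) at_top"
      by (rule tendsto_mult_right_zero)
  qed (use c in auto)
  also have "\<dots> < \<infinity>" by simp
  finally show ?thesis .
qed

text \<open>A lower Riemann sum with unit steps: on \<open>[i, i + 1)\<close> the increasing factor
  is at least its value at \<open>i\<close>, the decreasing one at least its value at
  \<open>i + 1\<close>.\<close>

lemma potential_survival_ge:
  assumes l: "0 \<le> l"
  shows "ennreal (\<Sum>i<k. exp (l * real i) * survival (real (Suc i)) n) \<le>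
    potential l n (indicator {0<..})"
proof -
  let ?c = "\<lambda>i. exp (l * real i) * survival (real (Suc i)) n"
  have "ennreal (\<Sum>i<k. ?c i) = (\<Sum>i<k. \<integral>\<^sup>+t. ennreal (?c i) * indicator {real i..<real (Suc i)} t \<partial>lborel)"
    by (simp add: nn_integral_cmult_indicator sum_ennreal)
  also have "\<dots> = (\<integral>\<^sup>+t. (\<Sum>i<k. ennreal (?c i) * indicator {real i..<real (Suc i)} t) \<partial>lborel)"
    by (rule nn_integral_sum[symmetric]) simp
  also have "\<dots> \<le> potential l n (indicator {0<..})"
    unfolding potential_def
  proof (rule nn_integral_mono)
    fix t
    show "(\<Sum>i<k. ennreal (?c i) * indicator {real i..<real (Suc i)} t) \<le>
        ennreal (exp (l * t)) * ((\<integral>\<^sup>+x. indicator {0<..} x \<partial>K t n) * indicator {0..} t)"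
    proof (cases "0 \<le> t")
      case True
      define j where "j = nat \<lfloor>t\<rfloor>"
      have j: "real j \<le> t" "t < real (Suc j)"
        using True unfolding j_def by (simp, linarith)
      have "indicator {real i..<real (Suc i)} t = (if i = j then 1 else 0 :: ennreal)" for i
        using j by (auto simp: indicator_def)
      then have "(\<Sum>i<k. ennreal (?c i) * indicator {real i..<real (Suc i)} t) =
          (\<Sum>i<k. if i = j then ennreal (?c j) else 0)"
        by (intro sum.cong) auto
      also have "\<dots> \<le> ennreal (?c j)"
        by simp
      also have "\<dots> \<le> ennreal (exp (l * t) * survival t n)"
        using j l by (auto intro!: ennreal_leI mult_mono mult_left_mono survival_antimono)
      also have "\<dots> = ennreal (exp (l * t)) * ((\<integral>\<^sup>+x. indicator {0<..} x \<partial>K t n) * indicator {0..} t)"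
        using True by (simp add: survival_def ennreal_mult measure_pmf.emeasure_eq_measure)
      finally show ?thesis .
    qed (auto intro!: sum_nonpos split: split_indicator)
  qed
  finally show ?thesis .
qed

section \<open>Limits of normalised resolvents\<close>

lemma limit_distribution:
  fixes \<nu> :: "nat \<Rightarrow> nat pmf"
  assumes l: "l \<longlonglongrightarrow> L"
    and \<nu>0: "\<And>k. pmf (\<nu> k) 0 = 0"
    and lower: "\<And>k s D. 0 \<le> s \<Longrightarrow> 0 \<notin> D \<Longrightarrow>
      exp (l k * s) * measure (bind_pmf (\<nu> k) (K s)) D \<le> measure (\<nu> k) D"
    and upper: "\<And>k s D. 0 \<le> s \<Longrightarrow> 0 \<notin> D \<Longrightarrow>
      measure (\<nu> k) D \<le> exp (l k * s) * measure (bind_pmf (\<nu> k) (K s)) D + s * exp (l k * s) / real (Suc k)"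
    and tight: "\<And>e. e > 0 \<Longrightarrow> \<exists>m. \<forall>\<^sub>F k in sequentially. measure (\<nu> k) {m..} \<le> e"
  obtains \<mu> where "pmf \<mu> 0 = 0"
    and "\<And>t y. 0 \<le> t \<Longrightarrow> 0 < y \<Longrightarrow> pmf (bind_pmf \<mu> (K t)) y = exp (- L * t) * pmf \<mu> y"
proof -
  obtain r \<mu> where r: "strict_mono r" and \<mu>: "\<And>y. (\<lambda>i. pmf (\<nu> (r i)) y) \<longlonglongrightarrow> pmf \<mu> y"
    using pmf_convergent_subsequence[OF tight] by blast
  have lr: "(\<lambda>i. l (r i)) \<longlonglongrightarrow> L"
    using LIMSEQ_subseq_LIMSEQ[OF l r] by (simp add: o_def)
  show ?thesis
  proof
    show "pmf \<mu> 0 = 0"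
      using \<mu>[of 0] \<nu>0 by (simp add: LIMSEQ_const_iff)
    fix t :: real and y :: nat assume t: "0 \<le> t" and y: "0 < y"
    \<comment> \<open>The transition probability into \<open>y\<close> is a bounded function of the
      starting point, so the limit passes through the infinite sum over \<open>x\<close>.\<close>
    have "(\<lambda>i. measure_pmf.expectation (\<nu> (r i)) (\<lambda>x. pmf (K t x) y)) \<longlonglongrightarrow>
        measure_pmf.expectation \<mu> (\<lambda>x. pmf (K t x) y)"
      by (rule expectation_pmf_tendsto[OF \<mu>]) (simp add: pmf_le_1)
    then have bind: "(\<lambda>i. pmf (bind_pmf (\<nu> (r i)) (K t)) y) \<longlonglongrightarrow> pmf (bind_pmf \<mu> (K t)) y"
      by (simp add: pmf_bind)
    have e: "(\<lambda>i. exp (l (r i) * t)) \<longlonglongrightarrow> exp (L * t)"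
      by (intro tendsto_intros lr)
    have "(\<lambda>i. 1 / real (Suc (r i))) \<longlonglongrightarrow> 0"
      using LIMSEQ_subseq_LIMSEQ[OF lim_1_over_n[THEN LIMSEQ_Suc] r] by (simp add: o_def)
    from tendsto_mult[OF tendsto_mult[OF tendsto_const[of t] e] this]
    have err: "(\<lambda>i. t * exp (l (r i) * t) / real (Suc (r i))) \<longlonglongrightarrow> 0"
      by simp
    \<comment> \<open>Both bounds are tested on \<open>D = {y}\<close>; since the error vanishes
      they coincide in the limit.\<close>
    have "exp (L * t) * pmf (bind_pmf \<mu> (K t)) y \<le> pmf \<mu> y"
      using lower[OF t, of "{y}"] y
      by (intro LIMSEQ_le[OF tendsto_mult[OF e bind] \<mu>]) (auto simp: measure_pmf_single)
    moreover have "pmf \<mu> y \<le> exp (L * t) * pmf (bind_pmf \<mu> (K t)) y + 0"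
      using upper[OF t, of "{y}"] y
      by (intro LIMSEQ_le[OF \<mu> tendsto_add[OF tendsto_mult[OF e bind] err]]) (auto simp: measure_pmf_single)
    ultimately have "pmf \<mu> y = exp (L * t) * pmf (bind_pmf \<mu> (K t)) y" by simp
    then show "pmf (bind_pmf \<mu> (K t)) y = exp (- L * t) * pmf \<mu> y"
      by (simp add: exp_minus field_simps)
  qed
qed

lemma resolvent_distribution_sequence:
  fixes l :: "nat \<Rightarrow> real" and n :: "nat \<Rightarrow> nat"
  assumes l: "\<And>k. 0 \<le> l k"
    and fin: "\<And>k. potential (l k) (n k) (indicator {0<..}) < \<infinity>"
    and ge: "\<And>k. ennreal (real (Suc k)) \<le> potential (l k) (n k) (indicator {0<..})"
  obtains \<nu> :: "nat \<Rightarrow> nat pmf" where "\<And>k. pmf (\<nu> k) 0 = 0"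
    and "\<And>k s D. 0 \<le> s \<Longrightarrow> 0 \<notin> D \<Longrightarrow>
      exp (l k * s) * measure (bind_pmf (\<nu> k) (K s)) D \<le> measure (\<nu> k) D"
    and "\<And>k s D. 0 \<le> s \<Longrightarrow> 0 \<notin> D \<Longrightarrow>
      measure (\<nu> k) D \<le> exp (l k * s) * measure (bind_pmf (\<nu> k) (K s)) D + s * exp (l k * s) / real (Suc k)"
proof -
  have "\<exists>\<nu>. pmf \<nu> 0 = 0 \<and> (\<forall>s D. 0 \<le> s \<longrightarrow> 0 \<notin> D \<longrightarrow>
      exp (l k * s) * measure (bind_pmf \<nu> (K s)) D \<le> measure \<nu> D \<and>
      measure \<nu> D \<le> exp (l k * s) * measure (bind_pmf \<nu> (K s)) D + s * exp (l k * s) / real (Suc k))" for k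
  proof -
    obtain u where u: "potential (l k) (n k) (indicator {0<..}) = ennreal u" "0 \<le> u"
      using fin[of k] by (cases "potential (l k) (n k) (indicator {0<..})") auto
    have u_ge: "real (Suc k) \<le> u"
      using ge[of k] u by (simp add: ennreal_le_iff del: of_nat_Suc)
    obtain \<nu> where "pmf \<nu> 0 = 0"
      and 1: "\<And>s D. 0 \<le> s \<Longrightarrow> 0 \<notin> D \<Longrightarrow>
        exp (l k * s) * measure (bind_pmf \<nu> (K s)) D \<le> measure \<nu> D"
      and 2: "\<And>s D. 0 \<le> s \<Longrightarrow> 0 \<notin> D \<Longrightarrow>
        measure \<nu> D \<le> exp (l k * s) * measure (bind_pmf \<nu> (K s)) D + s * exp (l k * s) / u"
      using resolvent_distribution[OF l u(1)] u_ge by (metis of_nat_0_less_iff order_less_le_trans zero_less_Suc)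
    moreover have "s * exp (l k * s) / u \<le> s * exp (l k * s) / real (Suc k)" if "0 \<le> s" for s
      using u_ge that by (intro divide_left_mono) (auto intro!: mult_pos_pos)
    ultimately show ?thesis
      by (intro exI[of _ \<nu>]) (meson add_left_mono order_trans)
  qed
  then show ?thesis
    using that by metis
qed

text \<open>The rate \<open>l / 2\<close> lies strictly below the rate at which survival from
  \<open>z\<close> decays, so all potentials are finite. They become arbitrarily large for remote
  starting points, from which survival stays at least 1/2 for a long time.\<close>

lemma quasi_stationary_if_remote:
  assumes mono: "\<And>i x y. 1 \<le> x \<Longrightarrow> x \<le> y \<Longrightarrow> survival (real i) x \<le> survival (real i) y"
    and irr: "\<And>x y. 1 \<le> x \<Longrightarrow> 1 \<le> y \<Longrightarrow> \<exists>t\<ge>0. 0 < pmf (K t x) y"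
    and l: "0 < l" and z: "1 \<le> z"
    and decay: "\<And>t. 0 \<le> t \<Longrightarrow> survival t z \<le> c * exp (- l * t)"
    and remote: "\<And>i. \<exists>x. 1 / 2 < survival (real i) x"
  obtains \<mu> where "pmf \<mu> 0 = 0"
    and "\<And>t y. 0 \<le> t \<Longrightarrow> 0 < y \<Longrightarrow> pmf (bind_pmf \<mu> (K t)) y = exp (- (l / 2) * t) * pmf \<mu> y"
proof -
  have fin: "potential (l / 2) n (indicator {0<..}) < \<infinity>" if n: "1 \<le> n" for n
  proof -
    \<comment> \<open>The decay at \<open>z\<close> is transferred to \<open>n\<close>: the state at
      time \<open>u\<close> is \<open>n\<close> with positive probability, so survival from
      \<open>n\<close> to time \<open>t\<close> is at most survival from \<open>z\<close> to time
      \<open>u + t\<close> divided by that probability.\<close>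
    obtain u where u: "0 \<le> u" "0 < pmf (K u z) n"
      using irr[OF z n] by blast
    have "survival t n \<le> (c * exp (- l * u) / pmf (K u z) n) * exp (- l * t)" if t: "0 \<le> t" for t
    proof -
      have "pmf (K u z) n * survival t n \<le> survival (u + t) z"
        unfolding survival_add[OF u(1) t] by (rule pmf_mult_le_expectation) auto
      also have "\<dots> \<le> c * exp (- l * (u + t))"
        using decay[of "u + t"] u t by simp
      also have "\<dots> = c * exp (- l * u) * exp (- l * t)"
        by (simp add: exp_add[symmetric] algebra_simps)
      finally show ?thesis
        using u by (simp add: field_simps)
    qed
    then show ?thesis
      using l by (intro potential_survival_finite[where r = l and c = "c * exp (- l * u) / pmf (K u z) n"]) auto
  qed
  have far: "\<exists>n\<ge>1. \<forall>y\<ge>n. 1 / 2 \<le> survival (real i) y" for i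
  proof -
    obtain x where x: "1 / 2 < survival (real i) x" using remote by blast
    then have "1 \<le> x" by (cases "x = 0") auto
    with x mono[of x _ i] show ?thesis
      by (intro exI[of _ x]) (auto intro: order_trans less_imp_le)
  qed
  have "\<exists>n\<ge>1. ennreal (real (Suc k)) \<le> potential (l / 2) n (indicator {0<..})" for k
  proof -
    \<comment> \<open>Survival of at least 1/2 up to time \<open>2 * Suc k\<close> makes each of the
      \<open>2 * Suc k\<close> terms of the lower Riemann sum at least 1/2.\<close>
    obtain n where n: "1 \<le> n" "\<And>y. n \<le> y \<Longrightarrow> 1 / 2 \<le> survival (real (2 * Suc k)) y"
      using far by blast
    have "real (Suc k) = (\<Sum>i<2 * Suc k. 1 / 2)" by simp
    also have "\<dots> \<le> (\<Sum>i<2 * Suc k. exp (l / 2 * real i) * survival (real (Suc i)) n)"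
    proof (rule sum_mono)
      fix i assume "i \<in> {..<2 * Suc k}"
      then have "1 / 2 \<le> survival (real (Suc i)) n"
        using n(2)[of n] survival_antimono[of "real (Suc i)" "real (2 * Suc k)" n] by simp
      then show "1 / 2 \<le> exp (l / 2 * real i) * survival (real (Suc i)) n"
        using mult_mono[of 1 "exp (l / 2 * real i)" "1 / 2" "survival (real (Suc i)) n"] l by simp
    qed
    finally have "ennreal (real (Suc k)) \<le>
        ennreal (\<Sum>i<2 * Suc k. exp (l / 2 * real i) * survival (real (Suc i)) n)"
      by (rule ennreal_leI)
    also have "\<dots> \<le> potential (l / 2) n (indicator {0<..})"
      using l by (intro potential_survival_ge) simp
    finally show ?thesis using n(1) by blast
  qed
  then obtain n where n: "\<And>k. 1 \<le> n k"
    "\<And>k. ennreal (real (Suc k)) \<le> potential (l / 2) (n k) (indicator {0<..})"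
    by metis
  obtain \<nu> :: "nat \<Rightarrow> nat pmf" where \<nu>: "\<And>k. pmf (\<nu> k) 0 = 0"
    "\<And>k s D. 0 \<le> s \<Longrightarrow> 0 \<notin> D \<Longrightarrow>
      exp (l / 2 * s) * measure (bind_pmf (\<nu> k) (K s)) D \<le> measure (\<nu> k) D"
    "\<And>k s D. 0 \<le> s \<Longrightarrow> 0 \<notin> D \<Longrightarrow>
      measure (\<nu> k) D \<le> exp (l / 2 * s) * measure (bind_pmf (\<nu> k) (K s)) D + s * exp (l / 2 * s) / real (Suc k)"
    using resolvent_distribution_sequence[of "\<lambda>_. l / 2" n, OF _ fin[OF n(1)] n(2)] l by auto
  have tight: "\<exists>m. \<forall>\<^sub>F k in sequentially. measure (\<nu> k) {m..} \<le> e" if e: "e > 0" for e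
  proof -
    \<comment> \<open>Mass of \<open>\<nu> k\<close> beyond \<open>m\<close> survives to time
      \<open>i\<close> with probability at least 1/2, while the total survival probability from
      \<open>\<nu> k\<close> is at most \<open>exp (- (l / 2) * i)\<close>. Hence that mass is at
      most twice this exponential.\<close>
    have "((\<lambda>i. exp (- (l / 2) * real i)) \<longlongrightarrow> 0) sequentially"
      using l by (intro filterlim_compose[OF exp_at_bot] filterlim_tendsto_neg_mult_at_bot[OF tendsto_const _ filterlim_real_sequentially]) auto
    then have "\<forall>\<^sub>F i in sequentially. exp (- (l / 2) * real i) < e / 2"
      using e by (intro order_tendstoD) auto
    then obtain i where i: "exp (- (l / 2) * real i) < e / 2"
      by (auto simp: eventually_sequentially)
    obtain m where m: "1 \<le> m" "\<And>y. m \<le> y \<Longrightarrow> 1 / 2 \<le> survival (real i) y"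
      using far by blast
    have "measure (\<nu> k) {m..} \<le> e" for k
    proof -
      have "measure (\<nu> k) {m..} / 2 = measure_pmf.expectation (\<nu> k) (\<lambda>x. indicator {m..} x / 2)"
        by simp
      also have "\<dots> \<le> measure_pmf.expectation (\<nu> k) (survival (real i))"
        using m by (intro integral_mono integrable_survival measure_pmf.integrable_const_bound[where B = 1])
          (auto split: split_indicator)
      also have "\<dots> = measure (bind_pmf (\<nu> k) (K (real i))) {0<..}"
        by (simp add: measure_bind_K survival_def[abs_def])
      also have "\<dots> \<le> exp (- (l / 2) * real i)"
      proof -
        have "exp (l / 2 * real i) * measure (bind_pmf (\<nu> k) (K (real i))) {0<..} \<le> 1"
          by (rule order_trans[OF \<nu>(2)]) auto
        then show ?thesis by (simp add: exp_minus field_simps)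
      qed
      finally show ?thesis using i by simp
    qed
    then show ?thesis by (intro exI[of _ m] always_eventually allI)
  qed
  obtain \<mu> where "pmf \<mu> 0 = 0"
    "\<And>t y. 0 \<le> t \<Longrightarrow> 0 < y \<Longrightarrow> pmf (bind_pmf \<mu> (K t)) y = exp (- (l / 2) * t) * pmf \<mu> y"
    using limit_distribution[of "\<lambda>_. l / 2", OF tendsto_const \<nu> tight] by auto
  then show ?thesis by (rule that)
qed

text \<open>Started in 1, the chain is in 1 at time \<open>i * h\<close> with probability at least
  \<open>?p ^ i\<close>, so survival cannot decay faster than at rate \<open>- ln ?p / h\<close>.
  This keeps the supremum of the uniform rates finite.\<close>

lemma decay_rate_bounded:
  "\<exists>b. \<forall>l c. (\<forall>t\<ge>0. survival t 1 \<le> c * exp (- l * t)) \<longrightarrow> l \<le> b"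
proof -
  have "\<forall>\<^sub>F h in at_right 0. 0 < pmf (K h 1) 1"
    using K_cont by (rule order_tendstoD) simp
  with eventually_at_right_less have "\<forall>\<^sub>F h in at_right 0. 0 < h \<and> 0 < pmf (K h 1) 1"
    by (rule eventually_conj)
  then obtain h where h: "h > 0" "0 < pmf (K h 1) 1"
    using eventually_happens'[OF trivial_limit_at_right_real] by blast
  let ?p = "pmf (K h 1) 1"
  have pow: "?p ^ i \<le> pmf (K (real i * h) 1) 1" for i
  proof (induction i)
    case (Suc i)
    have "?p * ?p ^ i \<le> ?p * pmf (K (real i * h) 1) 1"
      using Suc by (intro mult_left_mono) auto
    also have "\<dots> \<le> measure_pmf.expectation (K h 1) (\<lambda>z. pmf (K (real i * h) z) 1)"
      by (rule pmf_mult_le_expectation) (auto simp: pmf_le_1)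
    also have "\<dots> = pmf (K (real (Suc i) * h) 1) 1"
      using h K_add[of h "real i * h" 1] by (simp add: pmf_bind distrib_right)
    finally show ?case by simp
  qed (simp add: K_0)
  have "l \<le> - ln ?p / h" if le: "\<forall>t\<ge>0. survival t 1 \<le> c * exp (- l * t)" for l c
  proof (rule ccontr)
    assume "\<not> l \<le> - ln ?p / h"
    then have "- ln ?p < l * h" using h by (simp add: field_simps)
    then have "1 < exp (ln ?p + l * h)" by simp
    then have gt: "1 < ?p * exp (l * h)" using h by (simp add: exp_add)
    then obtain i where i: "c < (?p * exp (l * h)) ^ i"
      using real_arch_pow by blast
    have "?p ^ i \<le> survival (real i * h) 1"
      by (rule order_trans[OF pow]) (auto simp: survival_def measure_pmf_single[symmetric] intro!: measure_pmf.finite_measure_mono)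
    also have "\<dots> \<le> c * exp (- l * (real i * h))"
      using le h by simp
    finally have "?p ^ i * exp (l * h) ^ i \<le> c"
      by (simp add: exp_minus field_simps exp_of_nat_mult[symmetric])
    with i show False by (simp add: power_mult_distrib)
  qed
  then show ?thesis by blast
qed

text \<open>Below the best uniform rate \<open>L\<close> all potentials are finite, and as the rate
  approaches \<open>L\<close> they become arbitrarily large for suitable starting points. Tightness
  comes from \<open>entrance\<close> after running the semigroup for one unit of time.\<close>

lemma quasi_stationary_if_entrance:
  assumes mono: "\<And>i x y. 1 \<le> x \<Longrightarrow> x \<le> y \<Longrightarrow> survival (real i) x \<le> survival (real i) y"
    and entrance: "\<And>e. 0 < e \<Longrightarrow> \<exists>m. \<forall>x. measure (K 1 x) {m..} \<le> e"
    and l0: "0 < l0" and decay: "\<And>t x. 0 \<le> t \<Longrightarrow> survival t x \<le> c0 * exp (- l0 * t)"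
  obtains L \<mu> where "0 < L" "pmf \<mu> 0 = 0"
    and "\<And>t y. 0 \<le> t \<Longrightarrow> 0 < y \<Longrightarrow> pmf (bind_pmf \<mu> (K t)) y = exp (- L * t) * pmf \<mu> y"
proof -
  define R where "R = {l. 0 < l \<and> (\<exists>c. \<forall>t\<ge>0. \<forall>x. survival t x \<le> c * exp (- l * t))}"
  define L where "L = Sup R"
  have l0R: "l0 \<in> R"
    using l0 decay by (auto simp: R_def)
  have "bdd_above R"
    using decay_rate_bounded unfolding R_def bdd_above_def by blast
  then have L_upper: "l \<le> L" if "l \<in> R" for l
    using that by (simp add: L_def cSup_upper)
  have L: "0 < L"
    using L_upper[OF l0R] l0 by simp
  have below: "\<exists>c r. l < r \<and> (\<forall>t\<ge>0. \<forall>x. survival t x \<le> c * exp (- r * t))" if "l < L" for l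
    using less_cSupD[of R l] l0R that unfolding L_def R_def by blast
  have fin: "potential l n (indicator {0<..}) < \<infinity>" if "l < L" for l n
    using below[OF that] potential_survival_finite by blast
  \<comment> \<open>If \<open>l > L\<close>, then at each time \<open>i \<ge> 1\<close> some state
    violates the bound \<open>exp (- l * i)\<close>, as otherwise
    \<open>survival_uniform_decay\<close> would make \<open>l\<close> a uniform rate. By
    monotonicity the maximum of finitely many such states violates all the bounds at once.\<close>
  have above: "\<exists>x\<ge>1. \<forall>i\<in>{1..m}. exp (- l * real i) < survival (real i) x" if l: "L < l" for l m
  proof (induction m)
    case (Suc m)
    then obtain x where x: "1 \<le> x" "\<And>i. i \<in> {1..m} \<Longrightarrow> exp (- l * real i) < survival (real i) x"
      by blast
    have "\<exists>y. exp (- l * real (Suc m)) < survival (real (Suc m)) y"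
    proof (rule ccontr)
      assume "\<not> ?thesis"
      then have "survival u x \<le> exp (l * real (Suc m)) * exp (- l * u)" if "0 \<le> u" for u x
        using that l L by (intro survival_uniform_decay) (auto simp: not_less)
      with l L have "l \<in> R"
        unfolding R_def by auto
      with L_upper l show False by force
    qed
    then obtain y where y: "exp (- l * real (Suc m)) < survival (real (Suc m)) y" by blast
    then have "1 \<le> y"
      using order_less_trans[OF exp_gt_zero y] by (cases "y = 0") auto
    have "exp (- l * real i) < survival (real i) (max x y)" if "i \<in> {1..Suc m}" for i
      using that x(1) \<open>1 \<le> y\<close> y x(2)[of i] mono[of x "max x y" i] mono[of y "max x y" i]
      by (cases "i = Suc m") (auto simp del: of_nat_Suc)
    then show ?case
      using x(1) by (intro exI[of _ "max x y"]) auto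
  qed auto
  have "\<exists>l n. 0 \<le> l \<and> l < L \<and> L - 1 / real (Suc k) \<le> l \<and>
      ennreal (real (Suc k)) \<le> potential l n (indicator {0<..})" for k
  proof -
    obtain m where m: "real (Suc k) * exp (L + 3) < real m"
      using reals_Archimedean2 by blast
    have "0 < real (Suc k) * exp (L + 3)" by simp
    from less_trans[OF this m] have m0: "0 < m" by simp
    \<comment> \<open>The bound \<open>1 / m\<close> limits the loss in the exponent:
      \<open>(L + h) * (i + 1) - (L - h) * i = L + h + 2 * h * i\<close>, which is at most
      \<open>L + 3\<close> for \<open>i < m\<close>. The other two bounds make the rates
      \<open>L - h\<close> converge to \<open>L\<close> and keep them nonnegative.\<close>
    define h where "h = Min {1 / real m, 1 / real (Suc k), L}"
    have h: "0 < h" "h \<le> 1 / real m" "h \<le> 1 / real (Suc k)" "h \<le> L"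
      using L m0 by (auto simp: h_def)
    have "L < L + h" using h(1) by simp
    from above[OF this, of m] obtain n
      where n: "\<forall>i\<in>{1..m}. exp (- (L + h) * real i) < survival (real i) n"
      by blast
    have "real (Suc k) = real (Suc k) * exp (L + 3) * exp (- (L + 3))"
      by (simp only: mult.assoc exp_minus_inverse mult_1_right)
    also have "\<dots> \<le> (\<Sum>i<m. exp (- (L + 3)))"
      using mult_right_mono[OF less_imp_le[OF m], of "exp (- (L + 3))"] by simp
    also have "\<dots> \<le> (\<Sum>i<m. exp ((L - h) * real i) * survival (real (Suc i)) n)"
    proof (rule sum_mono)
      fix i assume i: "i \<in> {..<m}"
      have "h * real i \<le> h * real m"
        using i h by (intro mult_left_mono) auto
      also have "h * real m \<le> 1"
        using h(2) m0 by (simp add: field_simps)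
      finally have "h * real i \<le> 1" .
      moreover have "h \<le> 1"
        using order_trans[OF h(2), of 1] m0 by (simp add: divide_le_eq_1)
      ultimately have "exp (- (L + 3)) \<le> exp ((L - h) * real i + - (L + h) * real (Suc i))"
        by (simp add: algebra_simps)
      also have "\<dots> \<le> exp ((L - h) * real i) * survival (real (Suc i)) n"
        unfolding exp_add using bspec[OF n, of "Suc i"] i by (intro mult_left_mono) (auto simp del: of_nat_Suc)
      finally show "exp (- (L + 3)) \<le> exp ((L - h) * real i) * survival (real (Suc i)) n" .
    qed
    finally have "ennreal (real (Suc k)) \<le>
        ennreal (\<Sum>i<m. exp ((L - h) * real i) * survival (real (Suc i)) n)"
      by (rule ennreal_leI)
    also have "\<dots> \<le> potential (L - h) n (indicator {0<..})"
      using h by (intro potential_survival_ge) simp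
    finally show ?thesis
      using h by (intro exI[of _ "L - h"] exI[of _ n]) (auto simp del: of_nat_Suc)
  qed
  then obtain l n where l: "\<And>k. 0 \<le> l k" "\<And>k. l k < L" "\<And>k. L - 1 / real (Suc k) \<le> l k"
    and ge: "\<And>k. ennreal (real (Suc k)) \<le> potential (l k) (n k) (indicator {0<..})"
    by metis
  have inv: "(\<lambda>k. 1 / real (Suc k)) \<longlonglongrightarrow> 0"
    by (rule lim_1_over_n[THEN LIMSEQ_Suc])
  have "l \<longlonglongrightarrow> L"
  proof (rule tendsto_sandwich)
    show "(\<lambda>k. L - 1 / real (Suc k)) \<longlonglongrightarrow> L"
      using tendsto_diff[OF tendsto_const inv] by simp
  qed (use l(3) less_imp_le[OF l(2)] in auto)
  obtain \<nu> :: "nat \<Rightarrow> nat pmf" where \<nu>: "\<And>k. pmf (\<nu> k) 0 = 0"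
    "\<And>k s D. 0 \<le> s \<Longrightarrow> 0 \<notin> D \<Longrightarrow>
      exp (l k * s) * measure (bind_pmf (\<nu> k) (K s)) D \<le> measure (\<nu> k) D"
    "\<And>k s D. 0 \<le> s \<Longrightarrow> 0 \<notin> D \<Longrightarrow>
      measure (\<nu> k) D \<le> exp (l k * s) * measure (bind_pmf (\<nu> k) (K s)) D + s * exp (l k * s) / real (Suc k)"
    using resolvent_distribution_sequence[OF l(1) fin[OF l(2)] ge] by blast
  have tight: "\<exists>m. \<forall>\<^sub>F k in sequentially. measure (\<nu> k) {m..} \<le> e" if e: "e > 0" for e
  proof -
    \<comment> \<open>The bound will be \<open>exp L\<close> times two errors of size
      \<open>d\<close>: the tail of \<open>K 1 x\<close> and the defect of invariance.\<close>
    define d where "d = e / (2 * exp L)"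
    have d: "0 < d" using e by (simp add: d_def)
    obtain m where m: "\<And>x. measure (K 1 x) {m..} \<le> d"
      using entrance[OF d] by blast
    \<comment> \<open>The bounds for \<open>\<nu> k\<close> hold only on sets avoiding 0, which
      \<open>{m..}\<close> need not do.\<close>
    have m': "measure (K 1 x) {Suc m..} \<le> d" for x
      by (rule order_trans[OF measure_pmf.finite_measure_mono m[of x]]) auto
    have "\<forall>\<^sub>F k in sequentially. 1 / real (Suc k) < d"
      using inv d by (rule order_tendstoD)
    then have "\<forall>\<^sub>F k in sequentially. measure (\<nu> k) {Suc m..} \<le> e"
    proof eventually_elim
      case (elim k)
      have bind: "measure (bind_pmf (\<nu> k) (K 1)) {Suc m..} \<le> measure_pmf.expectation (\<nu> k) (\<lambda>_. d)"
        unfolding measure_bind_K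
        by (intro integral_mono m' measure_pmf.integrable_const measure_pmf.integrable_const_bound[where B = 1])
          auto
      have "measure (\<nu> k) {Suc m..} \<le>
          exp (l k) * (measure (bind_pmf (\<nu> k) (K 1)) {Suc m..} + 1 / real (Suc k))"
        using \<nu>(3)[of 1 "{Suc m..}" k] by (simp add: distrib_left)
      also have "\<dots> \<le> exp (l k) * (2 * d)"
        using bind elim by (intro mult_left_mono) auto
      also have "\<dots> \<le> exp L * (2 * d)"
        using d less_imp_le[OF l(2)] by (intro mult_right_mono) auto
      also have "\<dots> = e" by (simp add: d_def)
      finally show ?case by simp
    qed
    then show ?thesis by blast
  qed
  obtain \<mu> where "pmf \<mu> 0 = 0"
    "\<And>t y. 0 \<le> t \<Longrightarrow> 0 < y \<Longrightarrow> pmf (bind_pmf \<mu> (K t)) y = exp (- L * t) * pmf \<mu> y"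
    using limit_distribution[OF \<open>l \<longlonglongrightarrow> L\<close> \<nu> tight] by blast
  with L show ?thesis by (rule that)
qed

text \<open>Conditioned on survival to time \<open>i\<close> the law is again \<open>\<nu>\<close>,
  so the survival probability \<open>R\<close> from \<open>\<nu>\<close> is multiplicative on
  integer times. A state charged by \<open>\<nu>\<close> inherits the geometric rate because
  \<open>pmf \<nu> x * survival t x \<le> R t\<close>.\<close>

lemma survival_geometric_if_quasi_stationary:
  assumes pos: "0 < measure (bind_pmf \<nu> (K 1)) {0<..}"
    and qs: "\<And>t y. 0 \<le> t \<Longrightarrow> 0 < y \<Longrightarrow>
      pmf (bind_pmf \<nu> (K t)) y = measure (bind_pmf \<nu> (K t)) {0<..} * pmf \<nu> y"
    and \<nu>0: "pmf \<nu> 0 = 0"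
    and lim: "\<And>x. (\<lambda>i. survival (real i) x) \<longlonglongrightarrow> 0"
  obtains x c r where "1 \<le> x" "0 < r" "r < 1" "\<And>i. survival (real i) x \<le> c * r ^ i"
proof -
  define R where "R t = measure (bind_pmf \<nu> (K t)) {0<..}" for t
  have R_eq: "R t = measure_pmf.expectation \<nu> (survival t)" for t
    by (simp add: R_def measure_bind_K survival_def[abs_def])
  have R_Suc: "R (real (Suc i)) = R (real i) * R 1" for i
  proof -
    have "K (real (Suc i)) = (\<lambda>x. bind_pmf (K (real i) x) (K 1))"
      using K_add[of "real i" 1] by (simp add: fun_eq_iff add.commute)
    then have "bind_pmf \<nu> (K (real (Suc i))) = bind_pmf (bind_pmf \<nu> (K (real i))) (K 1)"
      by (simp add: bind_assoc_pmf)
    then have R_eq': "R (real (Suc i)) = measure_pmf.expectation (bind_pmf \<nu> (K (real i))) (survival 1)"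
      by (simp add: R_def measure_bind_K survival_def[abs_def])
    have scale: "pmf (bind_pmf \<nu> (K (real i))) y * survival 1 y =
        R (real i) * (pmf \<nu> y * survival 1 y)" for y
      using qs[of "real i" y] by (cases "y = 0") (auto simp: R_def)
    have "(\<lambda>y. pmf (bind_pmf \<nu> (K (real i))) y * survival 1 y) sums R (real (Suc i))"
      unfolding R_eq' by (rule expectation_pmf_nat_sums) simp
    then have "(\<lambda>y. R (real i) * (pmf \<nu> y * survival 1 y)) sums R (real (Suc i))"
      by (simp only: scale)
    moreover have "(\<lambda>y. R (real i) * (pmf \<nu> y * survival 1 y)) sums (R (real i) * R 1)"
      unfolding R_eq[of 1] by (intro sums_mult expectation_pmf_nat_sums) simp
    ultimately show ?thesis by (rule sums_unique2)
  qed
  have R_le: "pmf \<nu> x * survival t x \<le> R t" for x t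
    unfolding R_eq by (rule pmf_mult_le_expectation) auto
  have R_0: "R 0 = 1"
  proof -
    have "R 0 = measure \<nu> {0<..}"
      by (simp add: R_def K_0[abs_def] bind_return_pmf')
    also have "{0<..} = UNIV - {0 :: nat}" by auto
    also have "measure \<nu> \<dots> = 1"
      using measure_pmf.prob_compl[of "{0}" \<nu>] \<nu>0 by (simp add: measure_pmf_single)
    finally show ?thesis .
  qed
  have R_pow: "R (real i) = R 1 ^ i" for i
    by (induction i) (simp_all add: R_0 R_Suc del: of_nat_Suc)
  obtain x where x: "0 < pmf \<nu> x"
    using set_pmf_not_empty[of \<nu>] by (auto simp: set_pmf_iff pmf_positive_iff)
  then have "1 \<le> x" using \<nu>0 by (cases "x = 0") auto
  \<comment> \<open>If \<open>R 1 = 1\<close>, survival from \<open>\<nu>\<close> is certain at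
    every integer time, hence also from the charged state \<open>x\<close>, against
    \<open>lim\<close>.\<close>
  have "R 1 < 1"
  proof (rule ccontr)
    assume "\<not> R 1 < 1"
    then have R_1: "R 1 = 1" using measure_pmf.prob_le_1 by (metis R_def antisym_conv2)
    have "\<forall>\<^sub>F i in sequentially. survival (real i) x < 1"
      using lim[of x] by (rule order_tendstoD) simp
    then obtain i where i: "survival (real i) x < 1"
      by (auto simp: eventually_sequentially)
    have "pmf \<nu> x * (1 - survival (real i) x) \<le>
        measure_pmf.expectation \<nu> (\<lambda>y. 1 - survival (real i) y)"
      by (rule pmf_mult_le_expectation) auto
    also have "\<dots> = 1 - R (real i)"
      unfolding R_eq by (subst Bochner_Integration.integral_diff) (auto simp: integrable_survival)
    also have "\<dots> = 0" by (simp add: R_pow R_1)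
    finally have "pmf \<nu> x * (1 - survival (real i) x) \<le> 0" .
    moreover have "0 < pmf \<nu> x * (1 - survival (real i) x)"
      using x i by simp
    ultimately show False by simp
  qed
  moreover have "survival (real i) x \<le> (1 / pmf \<nu> x) * R 1 ^ i" for i
    using R_le[of x "real i"] x by (simp add: R_pow field_simps)
  moreover have "0 < R 1" using pos by (simp add: R_def)
  ultimately show ?thesis
    using \<open>1 \<le> x\<close> by (intro that)
qed

end

section \<open>Paths of the chain\<close>

context ctmc
begin

section \<open>Path events observed at rational times\<close>

lemma space_P [simp]: "space (P x) = space M"
  by (rule sets_eq_imp_space_eq) (rule sets_P)

lemma sets_P_iff [simp]: "A \<in> sets (P x) \<longleftrightarrow> A \<in> sets M"
  by (simp add: sets_P)

lemma X_event: "0 \<le> t \<Longrightarrow> {\<omega> \<in> space M. X t \<omega> \<in> D} \<in> sets M"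
  using measurable_sets[OF measurable_X, of t D] by (simp add: vimage_def Int_def conj_commute)

lemma X_eq_event: "0 \<le> t \<Longrightarrow> {\<omega> \<in> space M. X t \<omega> = y} \<in> sets M"
  using X_event[of t "{y}"] by simp

lemma right_constant:
  assumes "\<omega> \<in> space M" "0 \<le> t" "X t \<omega> \<noteq> None"
  obtains b where "t < b" "\<And>u. t \<le> u \<Longrightarrow> u < b \<Longrightarrow> X u \<omega> = X t \<omega>"
proof -
  have "ereal t < explosion_time X \<omega>"
    using killed[OF assms(1,2)] assms(3) by (simp add: not_le)
  from right_continuous[OF assms(1,2) this] obtain b
    where "t < b" "\<And>u. t < u \<Longrightarrow> u < b \<Longrightarrow> X u \<omega> = X t \<omega>"
    by (auto simp: eventually_at_right_field)
  then show ?thesis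
    by (intro that[of b]) (auto simp: le_less)
qed

lemma right_rational:
  assumes "\<omega> \<in> space M" "0 \<le> t" "X t \<omega> \<noteq> None" "t < c"
  obtains q where "q \<in> \<rat>" "t < q" "q < c" "X q \<omega> = X t \<omega>"
proof -
  obtain b where b: "t < b" "\<And>u. t \<le> u \<Longrightarrow> u < b \<Longrightarrow> X u \<omega> = X t \<omega>"
    using right_constant[OF assms(1-3)] by blast
  obtain q where "q \<in> \<rat>" "t < q" "q < min b c"
    using Rats_dense_in_real[of t "min b c"] b(1) assms(4) by auto
  moreover have "X q \<omega> = X t \<omega>"
    using \<open>t < q\<close> \<open>q < min b c\<close> by (intro b(2)) auto
  ultimately show ?thesis by (intro that[of q]) auto
qed

text \<open>By right-continuity a visit lasts for a short interval, hence shows at a rational time.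
  Measurability of hitting times follows.\<close>

lemma hitting_time_less_iff:
  assumes \<omega>: "\<omega> \<in> space M"
  shows "hitting_time X A \<omega> < c \<longleftrightarrow> (\<exists>q\<in>\<rat>. 0 < q \<and> ereal q < c \<and> X q \<omega> \<in> Some ` A)"
proof
  assume "hitting_time X A \<omega> < c"
  then obtain t where t: "0 < t" "X t \<omega> \<in> Some ` A" "ereal t < c"
    by (auto simp: hitting_time_def Inf_less_iff)
  obtain d where d: "t < d" "ereal d \<le> c"
    using t(3) by (cases c) (auto intro: that[of "t + 1"])
  obtain q where "q \<in> \<rat>" "t < q" "q < d" "X q \<omega> = X t \<omega>"
    using right_rational[OF \<omega>, of t d] t d by force
  with t d show "\<exists>q\<in>\<rat>. 0 < q \<and> ereal q < c \<and> X q \<omega> \<in> Some ` A"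
    by (intro bexI[of _ q]) (auto intro: less_le_trans[of "ereal q" "ereal d" c])
next
  assume "\<exists>q\<in>\<rat>. 0 < q \<and> ereal q < c \<and> X q \<omega> \<in> Some ` A"
  then show "hitting_time X A \<omega> < c"
    by (auto simp: hitting_time_def Inf_less_iff)
qed

lemma borel_measurable_hitting_time [measurable]: "hitting_time X A \<in> borel_measurable M"
proof (rule borel_measurableI_less)
  fix c
  have "{\<omega> \<in> space M. hitting_time X A \<omega> < c} =
      (\<Union>q\<in>{q\<in>\<rat>. 0 < q \<and> ereal q < c}. {\<omega> \<in> space M. X q \<omega> \<in> Some ` A})"
    by (auto simp: hitting_time_less_iff) blast+
  also have "\<dots> \<in> sets M"
    by (intro sets.countable_UN'') (auto intro!: X_event countable_subset[OF _ countable_rat])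
  finally show "{\<omega> \<in> space M. hitting_time X A \<omega> < c} \<in> sets M" .
qed

lemma AE_initial: "AE \<omega> in P x. X 0 \<omega> = Some x"
proof -
  interpret prob_space "P x" by (rule prob_space_P)
  show ?thesis
    using initial[of x] X_eq_event[of 0 "Some x"] by (subst prob_Collect_eq_1[symmetric]) auto
qed

lemma past_events_sets: "A \<in> past_events M X s \<Longrightarrow> A \<in> sets M"
  unfolding past_events_def
  by (rule subsetD[OF sets.sigma_sets_subset]) (auto intro: measurable_sets[OF measurable_X])

lemma sigma_algebra_past_events: "sigma_algebra (space M) (past_events M X s)"
  unfolding past_events_def by (rule sigma_algebra_sigma_sets) auto

lemma past_event: "0 \<le> u \<Longrightarrow> u \<le> s \<Longrightarrow> {\<omega> \<in> space M. X u \<omega> = a} \<in> past_events M X s"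
  unfolding past_events_def by (rule sigma_sets.Basic) (auto simp: vimage_def)

lemma markov_state:
  assumes "0 \<le> s" "0 \<le> t"
  shows "\<P>(\<omega> in P x. X s \<omega> = Some z \<and> X (s + t) \<omega> = Some y) =
    \<P>(\<omega> in P x. X s \<omega> = Some z) * \<P>(\<omega> in P z. X t \<omega> = Some y)"
proof -
  interpret sigma_algebra "space M" "past_events M X s" by (rule sigma_algebra_past_events)
  have eq: "{\<omega> \<in> space M. \<omega> \<in> space M \<and> Q \<omega>} = {\<omega> \<in> space M. Q \<omega>}" for Q by auto
  show ?thesis using markov[OF assms top, of x z y] by (simp add: eq)
qed

text \<open>
  A jump in \<open>(0, T]\<close> is visible on every sufficiently fine grid, while the expected number of such
  jumps on the grid of mesh \<open>1 / N\<close> is at most \<open>T * N * p (1 / N) x y\<close>, which tends to \<open>T * Q x y\<close>.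
\<close>

lemma AE_no_jump_of_rate_0:
  assumes "x \<noteq> y" "Q x y = 0"
  shows "AE \<omega> in P n. \<forall>u>0. \<not> ((\<forall>\<^sub>F v in at_left u. X v \<omega> = Some x) \<and> X u \<omega> = Some y)"
proof -
  interpret prob_space "P n" by (rule prob_space_P)
  define B where "B T N = {\<omega> \<in> space M. \<exists>k\<in>{..<T * N}.
    X (real k / real N) \<omega> = Some x \<and> X (real k / real N + 1 / real N) \<omega> = Some y}" for T N :: nat
  have B_sets: "B T N \<in> events" for T N
    unfolding B_def sets_P
    by (rule sets.sets_Collect_finite_Ex) (auto intro!: sets.sets_Collect_conj X_eq_event)
  have B_lim: "(\<lambda>N. prob (B T N)) \<longlonglongrightarrow> 0" for T
  proof -
    define f where "f N = \<P>(\<omega> in P x. X (1 / real N) \<omega> = Some y)" for N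
    have le: "prob (B T N) \<le> real T * (f N / (1 / real N))" for N
    proof -
      have "prob (B T N) \<le> (\<Sum>k<T * N. prob {\<omega> \<in> space M.
          X (real k / real N) \<omega> = Some x \<and> X (real k / real N + 1 / real N) \<omega> = Some y})"
      proof -
        have "B T N = (\<Union>k<T * N. {\<omega> \<in> space M.
            X (real k / real N) \<omega> = Some x \<and> X (real k / real N + 1 / real N) \<omega> = Some y})"
          by (auto simp: B_def)
        also have "prob \<dots> \<le> (\<Sum>k<T * N. prob {\<omega> \<in> space M.
          X (real k / real N) \<omega> = Some x \<and> X (real k / real N + 1 / real N) \<omega> = Some y})"
          by (rule finite_measure_subadditive_finite) (auto intro!: sets.sets_Collect_conj X_eq_event)
        finally show ?thesis .
      qed
      also have "\<dots> \<le> (\<Sum>k<T * N. f N)"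
      proof (rule sum_mono)
        fix k
        show "prob {\<omega> \<in> space M. X (real k / real N) \<omega> = Some x \<and>
            X (real k / real N + 1 / real N) \<omega> = Some y} \<le> f N"
          using markov_state[of "real k / real N" "1 / real N" n x y]
          by (simp add: f_def mult_left_le_one_le)
      qed
      finally show ?thesis by (simp add: mult_ac)
    qed
    have "(\<lambda>N. real T * (f N / (1 / real N))) \<longlonglongrightarrow> real T * Q x y"
    proof (intro tendsto_mult tendsto_const)
      have "filterlim (\<lambda>N. 1 / real N) (at_right 0) sequentially"
        using filterlim_compose[OF filterlim_inverse_at_right_top filterlim_real_sequentially]
        by (simp add: inverse_eq_divide)
      from filterlim_compose[OF Q_matrix[of x y] this]
      show "(\<lambda>N. f N / (1 / real N)) \<longlonglongrightarrow> Q x y"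
        using assms(1) by (simp add: f_def)
    qed
    then have "(\<lambda>N. real T * (f N / (1 / real N))) \<longlonglongrightarrow> 0"
      using assms(2) by simp
    then show ?thesis
      by (rule tendsto_sandwich[OF _ _ tendsto_const, rotated 2]) (use le in auto)
  qed
  have "AE \<omega> in P n. \<forall>T. \<not> (\<forall>\<^sub>F N in sequentially. \<omega> \<in> B T N)"
    unfolding AE_all_countable by (intro allI AE_not_eventually B_sets B_lim)
  then show ?thesis
  proof (rule AE_mp, intro AE_I2 impI allI notI)
    fix \<omega> u assume \<omega>: "\<omega> \<in> space (P n)" and B: "\<forall>T. \<not> (\<forall>\<^sub>F N in sequentially. \<omega> \<in> B T N)"
      and u: "0 < (u :: real)"
      and jump: "(\<forall>\<^sub>F v in at_left u. X v \<omega> = Some x) \<and> X u \<omega> = Some y"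
    obtain a where a: "a < u" "\<And>v. a < v \<Longrightarrow> v < u \<Longrightarrow> X v \<omega> = Some x"
      using jump by (auto simp: eventually_at_left_field)
    have "\<omega> \<in> space M" "X u \<omega> \<noteq> None" using \<omega> jump by auto
    from right_constant[OF this(1) less_imp_le[OF u] this(2)]
    obtain b where b: "u < b" "\<And>v. u \<le> v \<Longrightarrow> v < b \<Longrightarrow> X v \<omega> = X u \<omega>"
      by blast
    define T where "T = nat \<lceil>u\<rceil>"
    have T: "u \<le> real T" unfolding T_def by (rule real_nat_ceiling_ge)
    define e where "e = min (u - a) (b - u)"
    have e: "0 < e" "e \<le> u - a" "e \<le> b - u" using a b by (auto simp: e_def)
    have "\<omega> \<in> B T N" if N: "nat \<lceil>1 / e\<rceil> < N" for N
    proof -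
      have "0 < 1 / e" using e by simp
      then have N': "1 / e < real N" using N by linarith
      then have N0: "0 < real N" using \<open>0 < 1 / e\<close> by linarith
      have inv: "1 / real N < e" using N' N0 e by (simp add: field_simps)
      \<comment> \<open>\<open>k / N\<close> is the last grid point strictly before
        \<open>u\<close>, and its successor is at or after \<open>u\<close>. As the mesh is below
        \<open>e\<close>, they lie in the intervals on which the path is constantly \<open>x\<close>
        and \<open>y\<close>.\<close>
      define k where "k = nat (\<lceil>u * real N\<rceil> - 1)"
      have "0 < u * real N" using u N0 by simp
      then have k: "real k < u * real N" "u * real N \<le> real k + 1"
        unfolding k_def by linarith+
      have "real k < real T * real N"
        using k(1) mult_right_mono[OF T, of "real N"] by simp
      then have "k < T * N" by (simp flip: of_nat_mult)
      moreover have "X (real k / real N) \<omega> = Some x"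
      proof (rule a(2))
        show "real k / real N < u" using k(1) N0 by (simp add: field_simps)
        have "u \<le> real k / real N + 1 / real N"
          using k(2) N0 by (simp add: field_simps)
        then show "a < real k / real N" using inv e by linarith
      qed
      moreover have "X (real k / real N + 1 / real N) \<omega> = Some y"
      proof (subst b(2))
        show "u \<le> real k / real N + 1 / real N"
          using k(2) N0 by (simp add: field_simps)
        have "real k / real N < u" using k(1) N0 by (simp add: field_simps)
        then show "real k / real N + 1 / real N < b" using inv e by linarith
      qed (use jump in simp)
      ultimately show ?thesis
        using \<omega> by (auto simp: B_def)
    qed
    then have "\<forall>\<^sub>F N in sequentially. \<omega> \<in> B T N"
      by (rule eventually_mono[OF eventually_gt_at_top])
    with B show False by blast
  qed
qed

end

section \<open>Absorption at 0 and absence of killing\<close>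

locale absorbed_chain = downward_skip_free_chain +
  assumes hits_0: "\<P>(\<omega> in P x. hitting_time X {0} \<omega> < \<infinity>) = 1"
begin

lemma AE_hits_0: "AE \<omega> in P x. hitting_time X {0} \<omega> < \<infinity>"
proof -
  interpret prob_space "P x" by (rule prob_space_P)
  have "{\<omega> \<in> space M. hitting_time X {0} \<omega> < \<infinity>} \<in> sets M" by measurable
  then show ?thesis
    using hits_0[of x] by (subst prob_Collect_eq_1[symmetric]) auto
qed

text \<open>\<open>trap\<close> and the Markov property settle each pair of rational times, hence
  almost surely all of them together; right-continuity extends this to real times.\<close>

lemma AE_absorbed: "AE \<omega> in P x. \<forall>s\<ge>0. X s \<omega> = Some 0 \<longrightarrow> (\<forall>t\<ge>s. X t \<omega> = Some 0)"
proof -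
  interpret prob_space "P x" by (rule prob_space_P)
  have step: "AE \<omega> in P x. X s \<omega> = Some 0 \<longrightarrow> X (s + t) \<omega> = Some 0" if "0 \<le> s" "0 \<le> t" for s t
  proof -
    let ?A = "{\<omega> \<in> space M. X s \<omega> = Some 0}" and ?B = "{\<omega> \<in> space M. X s \<omega> = Some 0 \<and> X (s + t) \<omega> = Some 0}"
    have sets: "?A \<in> sets M" "?B \<in> sets M"
      using that by (auto intro!: sets.sets_Collect_conj X_eq_event)
    have "prob ?B = prob ?A"
      using markov_state[OF that, of x 0 0] trap[OF that(2)] by simp
    then have "prob (?A - ?B) = 0"
      using sets by (subst finite_measure_Diff) auto
    then have "AE \<omega> in P x. \<omega> \<notin> ?A - ?B"
      using sets by (subst prob_eq_0[symmetric]) auto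
    moreover have "AE \<omega> in P x. \<omega> \<in> space M"
      using AE_space[of "P x"] by simp
    ultimately show ?thesis by eventually_elim auto
  qed
  define R where "R = {q \<in> \<rat>. 0 \<le> (q :: real)}"
  have R: "countable R"
    unfolding R_def by (rule countable_subset[OF _ countable_rat]) auto
  have "AE \<omega> in P x. \<forall>s\<in>R. \<forall>t\<in>R. X s \<omega> = Some 0 \<longrightarrow> X (s + t) \<omega> = Some 0"
    unfolding AE_ball_countable[OF R] using step by (auto simp: R_def)
  then show ?thesis
  proof (rule AE_mp, intro AE_I2 impI allI)
    fix \<omega> s t assume \<omega>: "\<omega> \<in> space (P x)"
      and rat: "\<forall>s\<in>R. \<forall>t\<in>R. X s \<omega> = Some 0 \<longrightarrow> X (s + t) \<omega> = Some 0"
      and s: "0 \<le> s" "X s \<omega> = Some 0" and t: "s \<le> t"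
    have rat_0: "X r \<omega> = Some 0" if "r \<in> \<rat>" "s < r" for r
    proof -
      have "\<omega> \<in> space M" "X s \<omega> \<noteq> None" using \<omega> s by auto
      from right_rational[OF this(1) s(1) this(2) that(2)]
      obtain q where q: "q \<in> \<rat>" "s < q" "q < r" "X q \<omega> = X s \<omega>"
        by blast
      then have "X (q + (r - q)) \<omega> = Some 0"
        using rat s that by (intro bspec[OF bspec[OF rat], THEN mp]) (auto simp: R_def)
      then show ?thesis by simp
    qed
    show "X t \<omega> = Some 0"
    proof (cases "s = t")
      case False
      \<comment> \<open>A path killed at \<open>t\<close> would remain killed at later rational
        times, where it is known to be in 0.\<close>
      have "X t \<omega> \<noteq> None"
      proof
        assume None: "X t \<omega> = None"
        obtain r where r: "r \<in> \<rat>" "t < r"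
          using Rats_dense_in_real[of t "t + 1"] by auto
        have "explosion_time X \<omega> \<le> ereal t"
          using killed[of \<omega> t] \<omega> s t None by simp
        also have "\<dots> \<le> ereal r" using r by simp
        finally have "X r \<omega> = None"
          using killed[of \<omega> r] \<omega> s t r by simp
        then show False using rat_0[of r] r t by simp
      qed
      moreover have "\<omega> \<in> space M" "0 \<le> t" "t < t + 1" using \<omega> s t by auto
      ultimately obtain r where "r \<in> \<rat>" "t < r" "X r \<omega> = X t \<omega>"
        using right_rational by blast
      then show ?thesis using rat_0[of r] t by simp
    qed (use s in simp)
  qed
qed

text \<open>A visit of 0 at time \<open>u\<close> shows that explosion has not occurred up to
  \<open>u\<close>, and from \<open>u\<close> on the path sits in 0.\<close>

lemma AE_alive: "AE \<omega> in P x. \<forall>t\<ge>0. X t \<omega> \<noteq> None"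
  using AE_hits_0[of x] AE_absorbed[of x] AE_space[of "P x"]
proof eventually_elim
  case (elim \<omega>)
  have \<omega>: "\<omega> \<in> space M" using elim(3) by simp
  obtain u where u: "0 < u" "X u \<omega> = Some 0"
    using elim(1) hitting_time_less_iff[OF \<omega>, of "{0}" \<infinity>] by auto
  show ?case
  proof (intro allI impI)
    fix t :: real assume t: "0 \<le> t"
    show "X t \<omega> \<noteq> None"
    proof (cases "u \<le> t")
      case True
      then show ?thesis using elim(2)[rule_format, of u t] u by simp
    next
      case False
      have "ereal u < explosion_time X \<omega>"
        using killed[of \<omega> u] elim(3) u by (simp add: not_le)
      with False have "ereal t < explosion_time X \<omega>"
        by (meson ereal_less_le less_eq_real_def less_ereal.simps(1) not_le order_less_trans)
      then show ?thesis
        using killed[of \<omega> t] elim(3) t by (simp add: not_le)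
    qed
  qed
qed

lemma AE_hitting_time_0_iff:
  assumes t: "0 \<le> t"
  shows "AE \<omega> in P x. hitting_time X {0} \<omega> > ereal t \<longleftrightarrow> X t \<omega> \<in> Some ` {0<..}"
  using AE_alive[of x] AE_absorbed[of x] AE_space[of "P x"]
proof eventually_elim
  case (elim \<omega>)
  have "\<not> hitting_time X {0} \<omega> > ereal t" if "X t \<omega> = Some 0"
  proof -
    \<comment> \<open>Times strictly after \<open>t\<close> are needed because the hitting time
      ignores time 0, so for \<open>t = 0\<close> the time \<open>t\<close> itself does not
      count.\<close>
    have le: "hitting_time X {0} \<omega> \<le> ereal u" if "t < u" for u
      unfolding hitting_time_def using that t elim(2) \<open>X t \<omega> = Some 0\<close>
      by (intro Inf_lower) auto
    show ?thesis
    proof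
      assume "ereal t < hitting_time X {0} \<omega>"
      from ereal_dense2[OF this] obtain u where "t < u" "ereal u < hitting_time X {0} \<omega>"
        by auto
      with le[of u] show False by simp
    qed
  qed
  moreover have "hitting_time X {0} \<omega> > ereal t" if "X t \<omega> \<noteq> Some 0"
  proof -
    have "\<omega> \<in> space M" "X t \<omega> \<noteq> None" using elim(1,3) t by auto
    from right_constant[OF this(1) t this(2)]
    obtain b where b: "t < b" "\<And>u. t \<le> u \<Longrightarrow> u < b \<Longrightarrow> X u \<omega> = X t \<omega>"
      by blast
    have "ereal b \<le> hitting_time X {0} \<omega>"
      unfolding hitting_time_def
    proof (rule Inf_greatest, clarsimp)
      fix u :: real assume u: "0 < u" "X u \<omega> = Some 0"
      then have "\<not> u \<le> t" using elim(2)[rule_format, of u t] that by auto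
      moreover have "\<not> (t \<le> u \<and> u < b)" using b(2)[of u] u(2) that by auto
      ultimately show "b \<le> u" by auto
    qed
    then show ?thesis using b(1) by (meson less_ereal.simps(1) less_le_trans)
  qed
  ultimately show ?case
    using elim(1) t by (cases "X t \<omega>") (auto simp: image_iff)
qed

section \<open>The transition semigroup of the chain\<close>

definition law :: "real \<Rightarrow> nat \<Rightarrow> nat pmf" where
  "law t x = embed_pmf (\<lambda>y. \<P>(\<omega> in P x. X t \<omega> = Some y))"

lemma emeasure_X_in:
  assumes "0 \<le> t" and A: "A \<in> sets M"
  shows "emeasure (P x) {\<omega> \<in> space M. \<omega> \<in> A \<and> X t \<omega> \<in> Some ` D} =
    (\<integral>\<^sup>+y. emeasure (P x) {\<omega> \<in> space M. \<omega> \<in> A \<and> X t \<omega> = Some y} \<partial>count_space D)"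
proof -
  have "{\<omega> \<in> space M. \<omega> \<in> A \<and> X t \<omega> \<in> Some ` D} =
      (\<Union>y\<in>D. {\<omega> \<in> space M. \<omega> \<in> A \<and> X t \<omega> = Some y})"
    by auto
  then show ?thesis
    using assms by (auto intro!: emeasure_UN_countable sets.sets_Collect_conj X_eq_event
      simp: disjoint_family_on_def)
qed

lemma pmf_law:
  assumes t: "0 \<le> t"
  shows "pmf (law t x) y = \<P>(\<omega> in P x. X t \<omega> = Some y)"
  unfolding law_def
proof (rule pmf_embed_pmf)
  interpret prob_space "P x" by (rule prob_space_P)
  have "(\<integral>\<^sup>+y. ennreal (\<P>(\<omega> in P x. X t \<omega> = Some y)) \<partial>count_space UNIV) =
      emeasure (P x) {\<omega> \<in> space M. \<omega> \<in> space M \<and> X t \<omega> \<in> range Some}"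
    using t by (subst emeasure_X_in) (auto simp: emeasure_eq_measure intro!: nn_integral_cong arg_cong[where f = prob])
  \<comment> \<open>Almost sure survival from killing makes the masses sum to 1, which is what gives
    \<open>embed_pmf\<close> its meaning here.\<close>
  also have "\<dots> = 1"
  proof (rule emeasure_eq_1_AE)
    show "{\<omega> \<in> space M. \<omega> \<in> space M \<and> X t \<omega> \<in> range Some} \<in> events"
      using X_event[OF t, of "range Some"] by simp
    show "AE \<omega> in P x. \<omega> \<in> {\<omega> \<in> space M. \<omega> \<in> space M \<and> X t \<omega> \<in> range Some}"
      using AE_alive[of x] AE_space[of "P x"] by eventually_elim (use t in auto)
  qed
  finally show "(\<integral>\<^sup>+y. ennreal (\<P>(\<omega> in P x. X t \<omega> = Some y)) \<partial>count_space UNIV) = 1" .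
qed simp

lemma measure_law:
  assumes t: "0 \<le> t"
  shows "measure (law t x) D = \<P>(\<omega> in P x. X t \<omega> \<in> Some ` D)"
proof -
  interpret prob_space "P x" by (rule prob_space_P)
  have "emeasure (P x) {\<omega> \<in> space M. \<omega> \<in> space M \<and> X t \<omega> \<in> Some ` D} =
      (\<integral>\<^sup>+y. ennreal (pmf (law t x) y) \<partial>count_space D)"
    using t by (subst emeasure_X_in) (auto simp: pmf_law emeasure_eq_measure intro!: nn_integral_cong arg_cong[where f = prob])
  also have "\<dots> = emeasure (law t x) D"
    by (rule nn_integral_pmf)
  finally show ?thesis
    by (simp add: emeasure_eq_measure measure_pmf.emeasure_eq_measure)
qed

lemma markov_law:
  assumes st: "0 \<le> s" "0 \<le> t" and A: "A \<in> past_events M X s"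
  shows "\<P>(\<omega> in P x. (\<omega> \<in> A \<and> X s \<omega> = Some z) \<and> X (s + t) \<omega> \<in> Some ` D) =
    \<P>(\<omega> in P x. \<omega> \<in> A \<and> X s \<omega> = Some z) * measure (law t z) D"
proof -
  interpret prob_space "P x" by (rule prob_space_P)
  let ?B = "{\<omega> \<in> space M. \<omega> \<in> A \<and> X s \<omega> = Some z}"
  have B: "?B \<in> sets M"
    using past_events_sets[OF A] st by (auto intro!: sets.sets_Collect_conj X_eq_event)
  have "ennreal (\<P>(\<omega> in P x. (\<omega> \<in> A \<and> X s \<omega> = Some z) \<and> X (s + t) \<omega> \<in> Some ` D)) =
      emeasure (P x) {\<omega> \<in> space M. \<omega> \<in> ?B \<and> X (s + t) \<omega> \<in> Some ` D}"
    by (auto simp: emeasure_eq_measure intro!: arg_cong[where f = prob])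
  also have "\<dots> = (\<integral>\<^sup>+y. emeasure (P x) {\<omega> \<in> space M. \<omega> \<in> ?B \<and> X (s + t) \<omega> = Some y} \<partial>count_space D)"
    using st B by (intro emeasure_X_in) auto
  also have "\<dots> = (\<integral>\<^sup>+y. ennreal (prob ?B) * ennreal (pmf (law t z) y) \<partial>count_space D)"
  proof (rule nn_integral_cong)
    fix y
    have "prob {\<omega> \<in> space M. \<omega> \<in> ?B \<and> X (s + t) \<omega> = Some y} = prob ?B * pmf (law t z) y"
      using markov[OF st A, of x z y] st by (simp add: pmf_law conj_ac)
    then show "emeasure (P x) {\<omega> \<in> space M. \<omega> \<in> ?B \<and> X (s + t) \<omega> = Some y} =
        ennreal (prob ?B) * ennreal (pmf (law t z) y)"
      by (simp add: emeasure_eq_measure ennreal_mult)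
  qed
  also have "\<dots> = ennreal (prob ?B) * emeasure (law t z) D"
    by (simp add: nn_integral_cmult nn_integral_pmf)
  finally show ?thesis
    by (simp add: measure_pmf.emeasure_eq_measure ennreal_mult[symmetric])
qed

sublocale absorbed_semigroup law
proof
  fix x :: nat
  have "pmf (law 0 x) x = 1"
    using initial[of x] by (simp add: pmf_law)
  then show "law 0 x = return_pmf x"
    by (rule pmf_eq_1_imp_return_pmf)
next
  fix s t :: real and x assume st: "0 \<le> s" "0 \<le> t"
  interpret prob_space "P x" by (rule prob_space_P)
  show "law (s + t) x = bind_pmf (law s x) (law t)"
  proof (rule pmf_eqI)
    fix y
    have ae: "AE \<omega> in P x. X (s + t) \<omega> = Some y \<longleftrightarrow> X (s + t) \<omega> = Some y \<and> X s \<omega> \<in> range Some"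
      using AE_alive[of x] by eventually_elim (use st in auto)
    let ?A = "{\<omega> \<in> space M. X (s + t) \<omega> = Some y}"
    have A: "?A \<in> sets M" using st by (intro X_eq_event) simp
    have "ennreal (pmf (law (s + t) x) y) = emeasure (P x) {\<omega> \<in> space M. \<omega> \<in> ?A \<and> X s \<omega> \<in> range Some}"
      using st ae X_event[of s "range Some"] X_event[of "s + t" "{Some y}"]
      by (auto simp: pmf_law emeasure_eq_measure[symmetric] intro!: emeasure_eq_AE sets.sets_Collect_conj)
    also have "\<dots> = (\<integral>\<^sup>+z. emeasure (P x) {\<omega> \<in> space M. \<omega> \<in> ?A \<and> X s \<omega> = Some z} \<partial>count_space UNIV)"
      by (rule emeasure_X_in[OF st(1) A])
    also have "\<dots> = (\<integral>\<^sup>+z. ennreal (pmf (law s x) z) * ennreal (pmf (law t z) y) \<partial>count_space UNIV)"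
    proof (rule nn_integral_cong)
      fix z
      have "prob {\<omega> \<in> space M. \<omega> \<in> ?A \<and> X s \<omega> = Some z} = pmf (law s x) z * pmf (law t z) y"
        using markov_state[OF st, of x z y] st by (simp add: pmf_law conj_ac)
      then show "emeasure (P x) {\<omega> \<in> space M. \<omega> \<in> ?A \<and> X s \<omega> = Some z} =
          ennreal (pmf (law s x) z) * ennreal (pmf (law t z) y)"
        by (simp add: emeasure_eq_measure ennreal_mult)
    qed
    also have "\<dots> = ennreal (pmf (bind_pmf (law s x) (law t)) y)"
      by (simp add: ennreal_pmf_bind nn_integral_measure_pmf)
    finally show "pmf (law (s + t) x) y = pmf (bind_pmf (law s x) (law t)) y"
      by simp
  qed
next
  fix t :: real assume "0 \<le> t"
  then have "pmf (law t 0) 0 = 1"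
    using trap[of t] by (simp add: pmf_law)
  then show "law t 0 = return_pmf 0"
    by (rule pmf_eq_1_imp_return_pmf)
next
  fix x :: nat
  \<comment> \<open>The probability is rewritten as its difference quotient times \<open>t\<close>
    plus 1; finiteness of \<open>Q x x\<close> yields continuity at 0.\<close>
  have "((\<lambda>t. (\<P>(\<omega> in P x. X t \<omega> = Some x) - 1) / t * t + 1) \<longlongrightarrow> Q x x * 0 + 1) (at_right 0)"
    using Q_matrix[of x x] by (intro tendsto_intros) auto
  then have "((\<lambda>t. (\<P>(\<omega> in P x. X t \<omega> = Some x) - 1) / t * t + 1) \<longlongrightarrow> 1) (at_right 0)"
    by simp
  then show "((\<lambda>t. pmf (law t x) x) \<longlongrightarrow> 1) (at_right 0)"
    by (rule Lim_transform_eventually)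
       (auto simp: eventually_at_right_field pmf_law intro!: exI[of _ 1])
qed

section \<open>First visits of a grid\<close>

lemma AE_no_skip:
  "AE \<omega> in P n. \<forall>x y. y + 2 \<le> x \<longrightarrow>
    (\<forall>u>0. \<not> ((\<forall>\<^sub>F v in at_left u. X v \<omega> = Some x) \<and> X u \<omega> = Some y))"
  unfolding AE_all_countable
proof (intro allI)
  fix x y
  show "AE \<omega> in P n. y + 2 \<le> x \<longrightarrow>
    (\<forall>u>0. \<not> ((\<forall>\<^sub>F v in at_left u. X v \<omega> = Some x) \<and> X u \<omega> = Some y))"
    using AE_no_jump_of_rate_0[of x y n] skip_free[of y x] by (cases "y + 2 \<le> x") auto
qed

text \<open>Let \<open>u\<close> be the infimum of the times spent at levels at most
  \<open>m\<close>; by right-continuity it is attained. Were the level at \<open>u\<close> below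
  \<open>m\<close>, the left limit would lie above \<open>m\<close>, a downward jump of size at
  least 2.\<close>

lemma skip_free_path:
  assumes \<omega>: "\<omega> \<in> space M" and alive: "\<forall>t\<ge>0. X t \<omega> \<noteq> None"
    and no_skip: "\<forall>x y. y + 2 \<le> x \<longrightarrow>
      (\<forall>u>0. \<not> ((\<forall>\<^sub>F v in at_left u. X v \<omega> = Some x) \<and> X u \<omega> = Some y))"
    and start: "X 0 \<omega> = Some n" "m \<le> n" and t: "0 \<le> t" "X t \<omega> = Some j" "j \<le> m"
  obtains u where "0 \<le> u" "u \<le> t" "X u \<omega> = Some m"
proof -
  define S where "S = {v. 0 \<le> v \<and> v \<le> t \<and> the (X v \<omega>) \<le> m}"
  define u where "u = Inf S"
  have tS: "t \<in> S" using t by (simp add: S_def)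
  have bdd: "bdd_below S" unfolding S_def bdd_below_def by auto
  have u: "0 \<le> u" "u \<le> t"
    unfolding u_def using tS bdd
    by (auto intro!: cInf_greatest cInf_lower simp: S_def)
  obtain y where y: "X u \<omega> = Some y" using alive u by auto
  from right_constant[OF \<omega> u(1)] y obtain b
    where b: "u < b" and const: "\<And>v. u \<le> v \<Longrightarrow> v < b \<Longrightarrow> X v \<omega> = X u \<omega>"
    by auto
  obtain v where v: "v \<in> S" "v < b"
    using cInf_lessD[of S b] tS b unfolding u_def by auto
  have "u \<le> v" unfolding u_def by (rule cInf_lower[OF v(1) bdd])
  with const[OF this v(2)] v(1) y have y_le: "y \<le> m" by (simp add: S_def)
  have "y = m"
  proof (rule ccontr)
    assume "y \<noteq> m"
    then have "y < m" using y_le by simp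
    then have "u \<noteq> 0" using y start by auto
    then have "0 < u" using u by simp
    moreover have "ereal u < explosion_time X \<omega>"
      using killed[OF \<omega> u(1)] y by (simp add: not_le)
    ultimately obtain z where z: "\<forall>\<^sub>F v in at_left u. X v \<omega> = Some z"
      using left_limits[OF \<omega>] by blast
    have "\<forall>\<^sub>F v in at_left u. 0 < v \<and> v < u"
      using \<open>0 < u\<close> by (auto simp: eventually_at_left_field)
    with z have "\<forall>\<^sub>F v in at_left u. X v \<omega> = Some z \<and> 0 < v \<and> v < u"
      by (rule eventually_conj)
    then obtain v where v: "X v \<omega> = Some z" "0 < v" "v < u"
      using eventually_happens'[OF trivial_limit_at_left_real] by blast
    then have "v \<notin> S" using cInf_lower[OF _ bdd, of v] unfolding u_def by fastforce
    then have "m < z" using v u by (auto simp: S_def)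
    with \<open>y < m\<close> no_skip[rule_format, of y z u] \<open>0 < u\<close> z y show False by simp
  qed
  with u y show ?thesis by (intro that) auto
qed

text \<open>On its way to 0 the path stays at \<open>m\<close> throughout some interval starting at
  a time \<open>u \<le> T\<close>. Every grid of smaller mesh has a point in it, and the first one
  at or after \<open>u\<close> has index at most \<open>T * N\<close> because \<open>T\<close> is an
  integer.\<close>

lemma AE_grid_visit:
  assumes "m \<le> n"
  shows "AE \<omega> in P n. X (real T) \<omega> = Some 0 \<longrightarrow>
    (\<forall>\<^sub>F N in sequentially. \<exists>k\<le>T * N. X (real k / real N) \<omega> = Some m)"
  using AE_alive[of n] AE_no_skip[of n] AE_initial[of n] AE_space[of "P n"]
proof eventually_elim
  case (elim \<omega>)
  show ?case
  proof
    assume T: "X (real T) \<omega> = Some 0"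
    have \<omega>: "\<omega> \<in> space M" using elim(4) by simp
    obtain u where u: "0 \<le> u" "u \<le> real T" "X u \<omega> = Some m"
      using skip_free_path[OF \<omega> elim(1,2,3) assms _ T] by auto
    have "X u \<omega> \<noteq> None" using u by simp
    from right_constant[OF \<omega> u(1) this] obtain b
      where b: "u < b" and const: "\<And>v. u \<le> v \<Longrightarrow> v < b \<Longrightarrow> X v \<omega> = X u \<omega>"
      by blast
    have "\<exists>k\<le>T * N. X (real k / real N) \<omega> = Some m" if N: "nat \<lceil>1 / (b - u)\<rceil> < N" for N
    proof -
      have "0 < 1 / (b - u)" using b by simp
      then have N': "1 / (b - u) < real N" using N by linarith
      then have N0: "0 < real N" using \<open>0 < 1 / (b - u)\<close> by linarith
      have inv: "1 / real N < b - u" using N' N0 b by (simp add: field_simps)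
      define k where "k = nat \<lceil>u * real N\<rceil>"
      have "0 \<le> u * real N" using u by simp
      then have k: "u * real N \<le> real k" "real k < u * real N + 1"
        unfolding k_def by linarith+
      have "u * real N \<le> real (T * N)"
        using mult_right_mono[OF u(2), of "real N"] by simp
      then have "k \<le> T * N" unfolding k_def by linarith
      moreover have "X (real k / real N) \<omega> = X u \<omega>"
      proof (rule const)
        show "u \<le> real k / real N" using k(1) N0 by (simp add: field_simps)
        have "real k / real N < u + 1 / real N" using k(2) N0 by (simp add: field_simps)
        with inv show "real k / real N < b" by linarith
      qed
      ultimately show ?thesis using u(3) by auto
    qed
    then show "\<forall>\<^sub>F N in sequentially. \<exists>k\<le>T * N. X (real k / real N) \<omega> = Some m"
      by (rule eventually_mono[OF eventually_gt_at_top])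
  qed
qed

section \<open>Decomposition at the first grid visit of a level\<close>

definition first_visit :: "nat \<Rightarrow> nat \<Rightarrow> nat \<Rightarrow> 'a set" where
  "first_visit m N k = {\<omega> \<in> space M.
    (\<forall>i\<in>{..<k}. X (real i / real N) \<omega> \<noteq> Some m) \<and> X (real k / real N) \<omega> = Some m}"

lemma sets_first_visit: "first_visit m N k \<in> sets M"
proof -
  have "{\<omega> \<in> space M. \<forall>i\<in>{..<k}. X (real i / real N) \<omega> \<noteq> Some m} \<in> sets M"
    by (rule sets.sets_Collect_finite_All) (auto intro!: sets.sets_Collect_neg X_eq_event)
  then show ?thesis
    unfolding first_visit_def by (intro sets.sets_Collect_conj X_eq_event) auto
qed

lemma first_visit_unique: "\<omega> \<in> first_visit m N j \<Longrightarrow> \<omega> \<in> first_visit m N k \<Longrightarrow> j = k"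
  by (cases j k rule: linorder_cases) (auto simp: first_visit_def)

lemma UN_first_visit:
  "(\<Union>k\<in>{..L}. first_visit m N k) = {\<omega> \<in> space M. \<exists>k\<le>L. X (real k / real N) \<omega> = Some m}"
proof (intro equalityI subsetI)
  fix \<omega> assume "\<omega> \<in> {\<omega> \<in> space M. \<exists>k\<le>L. X (real k / real N) \<omega> = Some m}"
  then obtain k where k: "k \<le> L" "X (real k / real N) \<omega> = Some m" and \<omega>: "\<omega> \<in> space M" by auto
  define j where "j = (LEAST j. X (real j / real N) \<omega> = Some m)"
  have "X (real j / real N) \<omega> = Some m" unfolding j_def by (rule LeastI[of "\<lambda>j. X (real j / real N) \<omega> = Some m", OF k(2)])
  moreover have "j \<le> k" unfolding j_def by (rule Least_le[of "\<lambda>j. X (real j / real N) \<omega> = Some m", OF k(2)])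
  moreover have "X (real i / real N) \<omega> \<noteq> Some m" if "i < j" for i
    using not_less_Least[of i "\<lambda>j. X (real j / real N) \<omega> = Some m"] that by (simp add: j_def)
  ultimately show "\<omega> \<in> (\<Union>k\<in>{..L}. first_visit m N k)"
    using k(1) \<omega> by (auto simp: first_visit_def intro!: bexI[of _ j])
qed (auto simp: first_visit_def)

text \<open>The simple Markov property at the first visit of a grid replaces the strong Markov property.\<close>

lemma first_visit_markov:
  assumes "real k / real N \<le> t"
  shows "measure (P n) (first_visit m N k \<inter> {\<omega> \<in> space M. X t \<omega> \<in> Some ` D}) =
    measure (P n) (first_visit m N k) * measure (law (t - real k / real N) m) D"
proof -
  let ?s = "real k / real N"
  let ?A = "{\<omega> \<in> space M. \<forall>i\<in>{..<k}. X (real i / real N) \<omega> \<noteq> Some m}"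
  interpret A: sigma_algebra "space M" "past_events M X ?s" by (rule sigma_algebra_past_events)
  have A: "?A \<in> past_events M X ?s"
    by (rule A.sets_Collect_finite_All)
       (auto intro!: A.sets_Collect_neg past_event divide_right_mono)
  have "first_visit m N k \<inter> {\<omega> \<in> space M. X t \<omega> \<in> Some ` D} =
      {\<omega> \<in> space M. (\<omega> \<in> ?A \<and> X ?s \<omega> = Some m) \<and> X (?s + (t - ?s)) \<omega> \<in> Some ` D}"
    and "first_visit m N k = {\<omega> \<in> space M. \<omega> \<in> ?A \<and> X ?s \<omega> = Some m}"
    by (auto simp: first_visit_def)
  then show ?thesis
    using markov_law[OF _ _ A, of "t - ?s" n m D] assms by simp
qed

text \<open>First visits at different grid indices are disjoint, so the identities of
  \<open>first_visit_markov\<close> can be summed.\<close>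

lemma first_visit_bound:
  assumes I: "finite I" and t: "0 \<le> t" "\<And>k. k \<in> I \<Longrightarrow> real k / real N \<le> t"
    and c: "\<And>k. k \<in> I \<Longrightarrow> measure (law (t - real k / real N) m) D \<le> c"
  shows "measure (P n) ((\<Union>k\<in>I. first_visit m N k) \<inter> {\<omega> \<in> space M. X t \<omega> \<in> Some ` D}) \<le>
    c * measure (P n) (\<Union>k\<in>I. first_visit m N k)"
proof -
  interpret prob_space "P n" by (rule prob_space_P)
  let ?E = "{\<omega> \<in> space M. X t \<omega> \<in> Some ` D}"
  have E: "?E \<in> sets M" using t(1) by (rule X_event)
  have "prob ((\<Union>k\<in>I. first_visit m N k) \<inter> ?E) = prob (\<Union>k\<in>I. first_visit m N k \<inter> ?E)"
    by (rule arg_cong[where f = prob]) auto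
  also have "\<dots> = (\<Sum>k\<in>I. prob (first_visit m N k \<inter> ?E))"
    using I E sets_first_visit
    by (intro finite_measure_finite_Union) (auto simp: disjoint_family_on_def dest: first_visit_unique)
  also have "\<dots> \<le> (\<Sum>k\<in>I. c * prob (first_visit m N k))"
    using t c by (intro sum_mono) (auto simp: first_visit_markov mult.commute[of c] intro!: mult_left_mono)
  also have "\<dots> = c * prob (\<Union>k\<in>I. first_visit m N k)"
    using I sets_first_visit
    by (subst finite_measure_finite_Union)
       (auto simp: disjoint_family_on_def sum_distrib_left dest: first_visit_unique)
  finally show ?thesis .
qed

lemma measure_law_0: "0 \<le> t \<Longrightarrow> measure (law t x) {0} = 1 - survival t x"
proof -
  have "measure (law t x) (UNIV - {0<..}) = 1 - survival t x"
    unfolding survival_def by (subst measure_pmf.prob_compl[symmetric]) auto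
  moreover have "UNIV - {0<..} = {0 :: nat}" by auto
  ultimately show ?thesis by simp
qed

text \<open>For \<open>N > 0\<close> the indices up to \<open>N\<close> are exactly the grid points
  in the time interval \<open>[0, 1]\<close>.\<close>

definition grid_avoids :: "nat \<Rightarrow> nat \<Rightarrow> nat \<Rightarrow> real" where
  "grid_avoids n m N = 1 - measure (P n) (\<Union>k\<in>{..N}. first_visit m N k)"

lemma grid_avoids_nonneg: "0 \<le> grid_avoids n m N"
  unfolding grid_avoids_def using prob_space.prob_le_1[OF prob_space_P] by simp

text \<open>Being in 0 at time \<open>T + 1\<close> requires a grid visit of \<open>m\<close>, up to
  an error \<open>e N\<close>. After a visit by time 1, the chance of being in 0 is at most that
  from \<open>m\<close> with time \<open>T + 1\<close> available; after a later visit only time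
  \<open>T\<close> is left. Both monotonicity of survival and the entrance estimate come from
  this.\<close>

lemma grid_avoids_bound:
  assumes mn: "m \<le> n"
  obtains e where "e \<longlonglongrightarrow> 0"
    and "\<And>N. grid_avoids n m N * (survival (real T) m - survival (real (Suc T)) m) \<le>
      survival (real (Suc T)) n - survival (real (Suc T)) m + e N"
proof -
  interpret prob_space "P n" by (rule prob_space_P)
  let ?t = "real (Suc T)"
  let ?Z = "{\<omega> \<in> space M. X ?t \<omega> \<in> Some ` {0}}"
  define V where "V I N = (\<Union>k\<in>I. first_visit m N k)" for I N
  define e where "e N = prob (?Z - V {..Suc T * N} N)" for N
  have Z: "?Z \<in> sets M" by (rule X_event) simp
  have V: "V I N \<in> sets M" if "finite I" for I N
    unfolding V_def using that sets_first_visit by auto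
  have e_lim: "e \<longlonglongrightarrow> 0"
    unfolding e_def
  proof (rule prob_tendsto_0)
    show "?Z - V {..Suc T * N} N \<in> events" for N
      using Z V by auto
    show "AE \<omega> in P n. \<forall>\<^sub>F N in sequentially. \<omega> \<notin> ?Z - V {..Suc T * N} N"
      using AE_grid_visit[OF mn, of "Suc T"]
    proof eventually_elim
      case (elim \<omega>)
      show ?case
      proof (cases "\<omega> \<in> ?Z")
        case True
        then have ev: "\<forall>\<^sub>F N in sequentially. \<exists>k\<le>Suc T * N. X (real k / real N) \<omega> = Some m"
          using elim by simp
        show ?thesis
          using ev by (rule eventually_mono) (use True in \<open>simp add: V_def UN_first_visit del: mult_Suc\<close>)
      qed auto
    qed
  qed
  moreover have "grid_avoids n m N * (survival (real T) m - survival ?t m) \<le>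
      survival ?t n - survival ?t m + e N" for N
  proof -
    let ?I = "{..N}" and ?J = "{N<..Suc T * N}"
    \<comment> \<open>For \<open>N = 0\<close> the quotient is 0 by convention.\<close>
    have le_t: "real k / real N \<le> ?t" if "k \<le> Suc T * N" for k
      using that by (cases "N = 0") (auto simp: divide_le_eq simp flip: of_nat_mult of_nat_Suc simp del: mult_Suc)
    have N_le: "N \<le> Suc T * N" by simp
    have "{..Suc T * N} = ?I \<union> ?J" using N_le by auto
    then have V_split: "V {..Suc T * N} N = V ?I N \<union> V ?J N"
      unfolding V_def by (simp only: UN_Un)
    have "1 - survival ?t n = prob ?Z"
      using measure_law[of ?t n "{0}"] measure_law_0[of ?t n] by simp
    also have "?Z = (V ?I N \<inter> ?Z) \<union> (V ?J N \<inter> ?Z) \<union> (?Z - V {..Suc T * N} N)"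
      unfolding V_split by blast
    also have "prob \<dots> \<le> prob (V ?I N \<inter> ?Z) + prob (V ?J N \<inter> ?Z) + e N"
      unfolding e_def using Z V
      by (intro order_trans[OF measure_Un_le] add_right_mono measure_Un_le) auto
    finally have "1 - survival ?t n \<le> prob (V ?I N \<inter> ?Z) + prob (V ?J N \<inter> ?Z) + e N" .
    moreover have "prob (V ?I N \<inter> ?Z) \<le> (1 - survival ?t m) * prob (V ?I N)"
      unfolding V_def
    proof (rule first_visit_bound)
      fix k assume k: "k \<in> ?I"
      then have "real k / real N \<le> ?t" using N_le by (intro le_t) auto
      then show "measure (law (?t - real k / real N) m) {0} \<le> 1 - survival ?t m"
        by (simp add: measure_law_0 survival_antimono)
      show "real k / real N \<le> ?t" by fact
    qed auto
    moreover have "prob (V ?J N \<inter> ?Z) \<le> (1 - survival (real T) m) * prob (V ?J N)"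
      unfolding V_def
    proof (rule first_visit_bound)
      fix k assume k: "k \<in> ?J"
      then have le: "real k / real N \<le> ?t" by (intro le_t) auto
      \<comment> \<open>Indices above \<open>N\<close> belong to visits no earlier than time 1, so
        at most time \<open>T\<close> remains to be absorbed.\<close>
      have "1 \<le> real k / real N" if "N \<noteq> 0" using k that by (auto simp: le_divide_eq)
      moreover have "N \<noteq> 0" using k by (cases "N = 0") auto
      ultimately show "measure (law (?t - real k / real N) m) {0} \<le> 1 - survival (real T) m"
        using le by (simp add: measure_law_0 survival_antimono)
      show "real k / real N \<le> ?t" by (rule le)
    qed auto
    moreover have "prob (V ?J N) \<le> grid_avoids n m N"
    proof -
      have "prob (V ?I N) + prob (V ?J N) = prob (V ?I N \<union> V ?J N)"
        using V by (intro finite_measure_Union[symmetric]) (auto simp: V_def dest: first_visit_unique)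
      also have "\<dots> \<le> 1" by (rule prob_le_1)
      finally show ?thesis by (simp add: grid_avoids_def V_def)
    qed
    then have "(1 - survival (real T) m) * prob (V ?J N) \<le> (1 - survival (real T) m) * grid_avoids n m N"
      by (rule mult_left_mono) simp
    moreover have "prob (V ?I N) = 1 - grid_avoids n m N"
      by (simp add: grid_avoids_def V_def)
    ultimately show ?thesis by (simp add: algebra_simps)
  qed
  ultimately show ?thesis by (rule that)
qed

text \<open>The left side of \<open>grid_avoids_bound\<close> is nonnegative and its error vanishes
  as the grid is refined.\<close>

lemma survival_mono:
  assumes "1 \<le> m" "m \<le> n"
  shows "survival (real i) m \<le> survival (real i) n"
proof (cases i)
  case 0
  then show ?thesis using assms by (simp add: survival_def K_0)
next
  case (Suc T)
  obtain e where e: "e \<longlonglongrightarrow> 0" and le: "\<And>N. grid_avoids n m N * (survival (real T) m - survival (real (Suc T)) m) \<le>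
      survival (real (Suc T)) n - survival (real (Suc T)) m + e N"
    using grid_avoids_bound[OF assms(2)] by blast
  have ge: "0 \<le> survival (real (Suc T)) n - survival (real (Suc T)) m + e N" for N
    by (rule order_trans[OF _ le]) (intro mult_nonneg_nonneg grid_avoids_nonneg, simp add: survival_antimono)
  have "(\<lambda>N. survival (real (Suc T)) n - survival (real (Suc T)) m + e N) \<longlonglongrightarrow>
      survival (real (Suc T)) n - survival (real (Suc T)) m + 0"
    by (intro tendsto_intros e)
  from LIMSEQ_le_const[OF this, of 0] ge show ?thesis by (simp add: Suc)
qed

section \<open>Quasi-stationary distributions\<close>

lemma law_1_le:
  assumes c: "0 \<le> c" "\<And>k. k \<le> N \<Longrightarrow> measure (law (1 - real k / real N) m) D \<le> c"
  shows "measure (law 1 n) D \<le> c + grid_avoids n m N"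
proof -
  interpret prob_space "P n" by (rule prob_space_P)
  let ?E = "{\<omega> \<in> space M. X 1 \<omega> \<in> Some ` D}"
  define V where "V = (\<Union>k\<in>{..N}. first_visit m N k)"
  have sets: "?E \<in> events" "V \<in> events"
    using sets_first_visit by (auto simp: V_def intro!: X_event)
  have "prob (V \<inter> ?E) \<le> c * prob V"
    unfolding V_def by (rule first_visit_bound) (use c in \<open>auto simp: divide_le_eq\<close>)
  also have "\<dots> \<le> c" using c by (simp add: mult_left_le)
  finally have "prob (V \<inter> ?E) \<le> c" .
  moreover have "prob (?E - V) \<le> grid_avoids n m N"
  proof -
    have "prob (?E - V) \<le> prob (space (P n) - V)"
      using sets by (intro finite_measure_mono) auto
    also have "\<dots> = grid_avoids n m N"
      using sets by (subst prob_compl) (auto simp: grid_avoids_def V_def)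
    finally show ?thesis .
  qed
  moreover have "prob ?E \<le> prob (V \<inter> ?E) + prob (?E - V)"
  proof -
    have "?E = (V \<inter> ?E) \<union> (?E - V)" by blast
    also have "prob \<dots> \<le> prob (V \<inter> ?E) + prob (?E - V)"
      using sets by (intro measure_Un_le) auto
    finally show ?thesis .
  qed
  ultimately show ?thesis
    by (simp add: measure_law)
qed

text \<open>The explosion time exceeds 1, so a path stays bounded on \<open>[0, 1]\<close> and its
  maximum has a vanishing tail. Rational times keep the union countable and include the times
  \<open>1 - k / N\<close> remaining after a grid visit.\<close>

lemma running_maximum_tail:
  obtains b where "b \<longlonglongrightarrow> 0" "\<And>t k. t \<in> \<rat> \<Longrightarrow> 0 \<le> t \<Longrightarrow> t \<le> 1 \<Longrightarrow> measure (law t m) {k..} \<le> b k"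
proof -
  interpret prob_space "P m" by (rule prob_space_P)
  define R where "R = {q \<in> \<rat>. 0 \<le> q \<and> q \<le> (1 :: real)}"
  have R: "countable R"
    unfolding R_def by (rule countable_subset[OF _ countable_rat]) auto
  define A where "A k = (\<Union>q\<in>R. {\<omega> \<in> space M. X q \<omega> \<in> Some ` {k..}})" for k :: nat
  have A: "A k \<in> events" for k
    unfolding A_def sets_P using R by (intro sets.countable_UN'' X_event) (auto simp: R_def)
  have "(\<lambda>k. prob (A k)) \<longlonglongrightarrow> 0"
  proof (rule prob_tendsto_0[OF A])
    show "AE \<omega> in P m. \<forall>\<^sub>F k in sequentially. \<omega> \<notin> A k"
      using AE_alive[of m] AE_initial[of m] AE_space[of "P m"]
    proof eventually_elim
      case (elim \<omega>)
      have "ereal 1 < explosion_time X \<omega>"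
        using killed[of \<omega> 1] elim by (simp add: not_le)
      then obtain z where z: "ereal 1 < hitting_time X {z..} \<omega>"
        by (auto simp: explosion_time_eq_SUP less_SUP_iff)
      \<comment> \<open>Hitting times ignore time 0, so \<open>k\<close> must also exceed the
        starting state \<open>m\<close>.\<close>
      have "\<omega> \<notin> A k" if k: "max z (Suc m) \<le> k" for k
      proof
        assume "\<omega> \<in> A k"
        then obtain q where q: "0 \<le> q" "q \<le> 1" "X q \<omega> \<in> Some ` {k..}"
          by (auto simp: A_def R_def)
        then have "q \<noteq> 0" using elim(2) k by auto
        then have "hitting_time X {z..} \<omega> \<le> ereal q"
          unfolding hitting_time_def using q k by (intro Inf_lower) auto
        also have "\<dots> \<le> ereal 1" using q by simp
        finally show False using z by simp
      qed
      then show ?case unfolding eventually_sequentially by blast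
    qed
  qed
  moreover have "measure (law t m) {k..} \<le> prob (A k)" if "t \<in> \<rat>" "0 \<le> t" "t \<le> 1" for t k
    using that A unfolding measure_law[OF that(2)]
    by (intro finite_measure_mono) (auto simp: A_def R_def)
  ultimately show ?thesis by (rule that)
qed

text \<open>
  Let \<open>T + 1\<close> be the first integer time by which \<open>0\<close> is hit with probability bounded away from \<open>0\<close>
  uniformly in the starting point. A chain that starts above a large \<open>m\<close> and avoids \<open>m\<close> up to time
  \<open>1\<close> has only time \<open>T\<close> left to get from \<open>m\<close> to \<open>0\<close>, which is unlikely; hence it must reach \<open>m\<close> by
  time \<open>1\<close> with probability close to \<open>1\<close>.
\<close>

lemma law_1_tight:
  assumes i: "\<And>x. survival (real i) x \<le> 1 / 2" and e: "0 < e"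
  shows "\<exists>k. \<forall>x. measure (law 1 x) {k..} \<le> e"
proof -
  define g where "g i = (SUP x. survival (real i) x)" for i
  have bdd: "bdd_above (range (survival (real i)))" for i
    by (auto intro!: bdd_aboveI[of _ 1])
  have g_upper: "survival (real i) x \<le> g i" for i x
    unfolding g_def by (rule cSUP_upper[OF _ bdd]) simp
  have incseq: "incseq (survival (real i))" for i
  proof (rule incseq_SucI)
    show "survival (real i) x \<le> survival (real i) (Suc x)" for x
      by (cases "x = 0") (auto intro: survival_mono)
  qed
  have g_lim: "survival (real i) \<longlonglongrightarrow> g i" for i
    unfolding g_def by (rule LIMSEQ_incseq_SUP[OF bdd incseq])
  have "g i < 1"
  proof -
    have "g i \<le> 1 / 2" unfolding g_def using i by (intro cSUP_least) auto
    then show ?thesis by simp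
  qed
  \<comment> \<open>\<open>j\<close> is the first integer time with supremum below 1. It is positive
    since survival at time 0 from state 1 is 1, and minimality gives \<open>g T \<ge> 1\<close> for
    its predecessor \<open>T\<close>.\<close>
  then obtain j where j: "g j < 1" "\<And>i. i < j \<Longrightarrow> \<not> g i < 1"
    using exists_least_iff[of "\<lambda>i. g i < 1"] by blast
  have "g 0 \<ge> 1"
    using g_upper[of 0 1] by (simp add: survival_def K_0)
  with j obtain T where T: "j = Suc T" by (cases j) auto
  have gT: "1 \<le> g T" using j(2)[of T] T by simp
  define d where "d = g T - g (Suc T)"
  have d: "0 < d" using gT j(1) T by (simp add: d_def)
  \<comment> \<open>The constants are matched so that the avoidance probability times
    \<open>d / 2\<close> is at most \<open>d * e / 8 + d * e / 8\<close>, hence that probability is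
    at most \<open>e / 2\<close>.\<close>
  have "\<forall>\<^sub>F m in sequentially. d / 2 < survival (real T) m - survival (real (Suc T)) m"
    using d by (intro order_tendstoD[OF tendsto_diff[OF g_lim g_lim]]) (simp add: d_def)
  moreover have "\<forall>\<^sub>F m in sequentially. g (Suc T) - d * e / 8 < survival (real (Suc T)) m"
    using d e by (intro order_tendstoD[OF g_lim]) simp
  ultimately have "\<forall>\<^sub>F m in sequentially. d / 2 < survival (real T) m - survival (real (Suc T)) m \<and>
      g (Suc T) - d * e / 8 < survival (real (Suc T)) m"
    by (rule eventually_conj)
  then obtain m where m: "d / 2 < survival (real T) m - survival (real (Suc T)) m"
    "g (Suc T) - d * e / 8 < survival (real (Suc T)) m"
    unfolding eventually_sequentially by blast
  have avoid: "\<exists>N. grid_avoids n m N \<le> e / 2" if n: "m \<le> n" for n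
  proof -
    obtain r where r: "r \<longlonglongrightarrow> 0"
      "\<And>N. grid_avoids n m N * (survival (real T) m - survival (real (Suc T)) m) \<le>
        survival (real (Suc T)) n - survival (real (Suc T)) m + r N"
      using grid_avoids_bound[OF n] by blast
    have "\<forall>\<^sub>F N in sequentially. r N < d * e / 8"
      using d e by (intro order_tendstoD[OF r(1)]) simp
    then obtain N where N: "r N < d * e / 8"
      by (auto simp: eventually_sequentially)
    have "grid_avoids n m N * (d / 2) \<le>
        grid_avoids n m N * (survival (real T) m - survival (real (Suc T)) m)"
      using m(1) by (intro mult_left_mono grid_avoids_nonneg) simp
    also have "\<dots> \<le> survival (real (Suc T)) n - survival (real (Suc T)) m + r N"
      by (rule r(2))
    also have "\<dots> \<le> d * e / 8 + d * e / 8"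
      using m(2) g_upper[of "Suc T" n] N by linarith
    also have "\<dots> = (e / 2) * (d / 2)" by simp
    finally show ?thesis
      using d by (intro exI[of _ N]) (simp add: mult_le_cancel_right)
  qed
  obtain b where b: "b \<longlonglongrightarrow> 0"
    "\<And>t k. t \<in> \<rat> \<Longrightarrow> 0 \<le> t \<Longrightarrow> t \<le> 1 \<Longrightarrow> measure (law t m) {k..} \<le> b k"
    using running_maximum_tail[of m] by blast
  have "\<forall>\<^sub>F k in sequentially. b k < e / 2"
    using e by (intro order_tendstoD[OF b(1)]) simp
  \<comment> \<open>The finitely many starting points below \<open>m\<close> are tight
    individually.\<close>
  moreover have "\<forall>\<^sub>F k in sequentially. \<forall>x\<in>{..<m}. measure (law 1 x) {k..} < e"
  proof (intro eventually_ball_finite ballI)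
    fix x
    obtain b' where "b' \<longlonglongrightarrow> 0" and b': "\<And>k. measure (law 1 x) {k..} \<le> b' k"
      using running_maximum_tail[of x] by (metis Rats_1 order_refl zero_le_one)
    then have "\<forall>\<^sub>F k in sequentially. b' k < e"
      using e by (intro order_tendstoD[OF \<open>b' \<longlonglongrightarrow> 0\<close>]) simp
    then show "\<forall>\<^sub>F k in sequentially. measure (law 1 x) {k..} < e"
      by eventually_elim (rule le_less_trans[OF b'])
  qed simp
  ultimately have "\<forall>\<^sub>F k in sequentially. b k < e / 2 \<and> (\<forall>x\<in>{..<m}. measure (law 1 x) {k..} < e)"
    by (rule eventually_conj)
  then obtain k where k: "b k < e / 2" "\<And>x. x < m \<Longrightarrow> measure (law 1 x) {k..} < e"
    unfolding eventually_sequentially by blast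
  have "measure (law 1 x) {k..} \<le> e" for x
  proof (cases "x < m")
    case False
    then obtain N where N: "grid_avoids x m N \<le> e / 2"
      using avoid[of x] by auto
    have "measure (law 1 x) {k..} \<le> e / 2 + grid_avoids x m N"
    proof (rule law_1_le)
      fix j assume j: "j \<le> N"
      have "measure (law (1 - real j / real N) m) {k..} \<le> b k"
        using j by (intro b(2)) (auto simp: divide_le_eq)
      then show "measure (law (1 - real j / real N) m) {k..} \<le> e / 2"
        using k(1) by simp
    qed (use e in simp)
    with N show ?thesis by simp
  qed (use k(2) less_imp_le in blast)
  then show ?thesis by blast
qed

section \<open>Translation between the chain and its semigroup\<close>

lemma law_irreducible:
  assumes "1 \<le> x"
  shows "\<exists>t\<ge>0. 0 < pmf (law t x) y"
proof (rule ccontr)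
  interpret prob_space "P x" by (rule prob_space_P)
  assume none: "\<not> ?thesis"
  have ae: "AE \<omega> in P x. X q \<omega> \<noteq> Some y" if "0 \<le> q" for q
  proof -
    have "prob {\<omega> \<in> space M. X q \<omega> = Some y} = 0"
      using none pmf_law[OF that, of x y] pmf_nonneg[of "law q x" y] that by (metis less_eq_real_def space_P)
    then have "AE \<omega> in P x. \<omega> \<notin> {\<omega> \<in> space M. X q \<omega> = Some y}"
      using X_eq_event[OF that] by (subst prob_eq_0[symmetric]) auto
    with AE_space show ?thesis by eventually_elim auto
  qed
  \<comment> \<open>If all one-time probabilities vanish, almost surely no positive rational time
    shows \<open>y\<close>, so \<open>y\<close> is never hit, against
    \<open>irreducible\<close>.\<close>
  define R where "R = {q \<in> \<rat>. 0 < (q :: real)}"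
  have R: "countable R"
    unfolding R_def by (rule countable_subset[OF _ countable_rat]) auto
  have "AE \<omega> in P x. \<forall>q\<in>R. X q \<omega> \<noteq> Some y"
    unfolding AE_ball_countable[OF R] using ae by (auto simp: R_def)
  then have "AE \<omega> in P x. \<not> hitting_time X {y} \<omega> < \<infinity>"
    using AE_space
  proof eventually_elim
    case (elim \<omega>)
    then have "\<omega> \<in> space M" by simp
    from hitting_time_less_iff[OF this, of "{y}" \<infinity>] elim(1) show ?case
      by (auto simp: R_def)
  qed
  then have "\<P>(\<omega> in P x. hitting_time X {y} \<omega> < \<infinity>) = 0"
    by (subst prob_Collect_eq_0) auto
  with irreducible[OF assms, of y] show False by simp
qed

lemma survival_eq:
  assumes t: "0 \<le> t"
  shows "survival t x = measure (P x) {\<omega> \<in> space M. hitting_time X {0} \<omega> > ereal t}"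
proof -
  have "survival t x = measure (P x) {\<omega> \<in> space M. X t \<omega> \<in> Some ` {0<..}}"
    using t by (simp add: survival_def measure_law)
  also have "\<dots> = measure (P x) {\<omega> \<in> space M. hitting_time X {0} \<omega> > ereal t}"
  proof (rule measure_eq_AE)
    show "AE \<omega> in P x. \<omega> \<in> {\<omega> \<in> space M. X t \<omega> \<in> Some ` {0<..}} \<longleftrightarrow>
        \<omega> \<in> {\<omega> \<in> space M. hitting_time X {0} \<omega> > ereal t}"
      using AE_hitting_time_0_iff[OF t, of x] by eventually_elim auto
  qed (use t in \<open>auto intro!: X_event\<close>)
  finally show ?thesis .
qed

lemma survival_tendsto_0: "(\<lambda>i. survival (real i) x) \<longlonglongrightarrow> 0"
proof -
  interpret prob_space "P x" by (rule prob_space_P)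
  have "(\<lambda>i. prob {\<omega> \<in> space M. hitting_time X {0} \<omega> > ereal (real i)}) \<longlonglongrightarrow> 0"
  proof (rule prob_tendsto_0)
    show "AE \<omega> in P x. \<forall>\<^sub>F i in sequentially. \<omega> \<notin> {\<omega> \<in> space M. hitting_time X {0} \<omega> > ereal (real i)}"
      using AE_hits_0[of x]
    proof eventually_elim
      case (elim \<omega>)
      then obtain j where "hitting_time X {0} \<omega> < ereal (real j)"
        using less_PInf_Ex_of_nat by auto
      then have "\<omega> \<notin> {\<omega> \<in> space M. hitting_time X {0} \<omega> > ereal (real i)}" if "j \<le> i" for i
        using that by (auto dest: order.strict_trans)
      then show ?case unfolding eventually_sequentially by blast
    qed
  qed simp
  then show ?thesis by (simp add: survival_eq)
qed

lemma measure_mixture: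
  assumes A: "A \<in> sets M" and eq: "\<And>x. measure (P x) A = measure (law t x) D"
  shows "measure (mixture P \<nu>) A = measure (bind_pmf \<nu> (law t)) D"
proof -
  have "(\<lambda>x. pmf \<nu> x * measure (law t x) D) sums measure (mixture P \<nu>) A"
    using mixture_sums[OF A, of \<nu>] by (simp add: eq)
  moreover have "(\<lambda>x. pmf \<nu> x * measure (law t x) D) sums measure (bind_pmf \<nu> (law t)) D"
    unfolding measure_bind_K by (rule expectation_pmf_nat_sums) simp
  ultimately show ?thesis by (rule sums_unique2)
qed

text \<open>The intersection with \<open>{0<..}\<close> matters for \<open>y = 0\<close>:
  conditioned on survival the chain is almost surely not in 0, so a quasi-stationary distribution
  does not charge 0.\<close>

lemma quasi_stationary_iff:
  "quasi_stationary X P \<nu> \<longleftrightarrow>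
    (\<forall>t\<ge>0. 0 < measure (bind_pmf \<nu> (law t)) {0<..}) \<and>
    (\<forall>y. \<forall>t\<ge>0. pmf \<nu> y =
      measure (bind_pmf \<nu> (law t)) ({y} \<inter> {0<..}) / measure (bind_pmf \<nu> (law t)) {0<..})"
proof -
  have space: "space (mixture P \<nu>) = space M"
    by (rule sets_eq_imp_space_eq) (rule sets_mixture)
  have 1: "measure (mixture P \<nu>) {\<omega> \<in> space M. hitting_time X {0} \<omega> > ereal t} =
      measure (bind_pmf \<nu> (law t)) {0<..}" if "0 \<le> t" for t
    by (rule measure_mixture) (simp_all add: survival_eq[OF that, symmetric] survival_def)
  have 2: "measure (mixture P \<nu>) {\<omega> \<in> space M. X t \<omega> = Some y \<and> hitting_time X {0} \<omega> > ereal t} =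
      measure (bind_pmf \<nu> (law t)) ({y} \<inter> {0<..})" if t: "0 \<le> t" for t y
  proof (rule measure_mixture)
    show sets: "{\<omega> \<in> space M. X t \<omega> = Some y \<and> hitting_time X {0} \<omega> > ereal t} \<in> sets M"
      using t by (intro sets.sets_Collect_conj X_eq_event) auto
    fix x
    have "measure (P x) {\<omega> \<in> space M. X t \<omega> = Some y \<and> hitting_time X {0} \<omega> > ereal t} =
        measure (P x) {\<omega> \<in> space M. X t \<omega> \<in> Some ` ({y} \<inter> {0<..})}"
    proof (rule measure_eq_AE)
      show "AE \<omega> in P x. \<omega> \<in> {\<omega> \<in> space M. X t \<omega> = Some y \<and> hitting_time X {0} \<omega> > ereal t} \<longleftrightarrow>
          \<omega> \<in> {\<omega> \<in> space M. X t \<omega> \<in> Some ` ({y} \<inter> {0<..})}"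
        using AE_hitting_time_0_iff[OF t, of x] by eventually_elim auto
    qed (use sets X_event[OF t] in auto)
    then show "measure (P x) {\<omega> \<in> space M. X t \<omega> = Some y \<and> hitting_time X {0} \<omega> > ereal t} =
        measure (law t x) ({y} \<inter> {0<..})"
      using t by (simp add: measure_law)
  qed
  show ?thesis
    unfolding quasi_stationary_def cond_prob_def space using 1 2 by simp
qed

text \<open>Markov's inequality for a finite exponential moment of the hitting time of 0.\<close>

lemma survival_exponential_if_decay_parameter_pos:
  assumes "0 < decay_parameter X P"
  obtains l x c where "0 < l" "1 \<le> x" "\<And>t. 0 \<le> t \<Longrightarrow> survival t x \<le> c * exp (- l * t)"
proof -
  obtain l x where l: "0 < l" and x: "1 \<le> x"
    and fin: "(\<integral>\<^sup>+\<omega>. ext_exp (ereal l * hitting_time X {0} \<omega>) \<partial>P x) < \<infinity>"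
    using assms unfolding decay_parameter_def less_Sup_iff by auto
  interpret prob_space "P x" by (rule prob_space_P)
  obtain c where c: "(\<integral>\<^sup>+\<omega>. ext_exp (ereal l * hitting_time X {0} \<omega>) \<partial>P x) = ennreal c" "0 \<le> c"
    using fin by (cases "\<integral>\<^sup>+\<omega>. ext_exp (ereal l * hitting_time X {0} \<omega>) \<partial>P x") auto
  have "survival t x \<le> c * exp (- l * t)" if t: "0 \<le> t" for t
  proof -
    let ?A = "{\<omega> \<in> space M. hitting_time X {0} \<omega> > ereal t}"
    have A: "?A \<in> sets M" by measurable
    have "ennreal (exp (l * t)) * emeasure (P x) ?A = (\<integral>\<^sup>+\<omega>. ennreal (exp (l * t)) * indicator ?A \<omega> \<partial>P x)"
      using A by (subst nn_integral_cmult_indicator) auto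
    also have "\<dots> \<le> (\<integral>\<^sup>+\<omega>. ext_exp (ereal l * hitting_time X {0} \<omega>) \<partial>P x)"
    proof (rule nn_integral_mono)
      fix \<omega>
      show "ennreal (exp (l * t)) * indicator ?A \<omega> \<le> ext_exp (ereal l * hitting_time X {0} \<omega>)"
        using l by (cases "hitting_time X {0} \<omega>")
          (auto simp: ext_exp_def split: split_indicator intro!: ennreal_leI)
    qed
    finally have "exp (l * t) * survival t x \<le> c"
      using c t by (simp add: survival_eq emeasure_eq_measure ennreal_mult[symmetric] ennreal_le_iff)
    then show ?thesis by (simp add: exp_minus field_simps)
  qed
  with l x show ?thesis by (rule that)
qed

text \<open>If the hitting time lies in \<open>(i, i + 1]\<close>, its exponential is at most
  \<open>exp (l * (i + 1))\<close>, so the moment is dominated by a geometric series. The extra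
  summand 1 covers a hitting time equal to 0.\<close>

lemma decay_parameter_pos_if_survival_geometric:
  assumes x: "1 \<le> x" and r: "0 < r" "r < 1" and le: "\<And>i. survival (real i) x \<le> c * r ^ i"
  shows "0 < decay_parameter X P"
proof -
  interpret prob_space "P x" by (rule prob_space_P)
  \<comment> \<open>Using half of the available rate makes the ratio \<open>exp l * r\<close> the
    square root of \<open>r\<close>, which is below 1.\<close>
  define l where "l = - ln r / 2"
  have l: "0 < l" using r by (simp add: l_def)
  have "exp l * r = exp (l + ln r)"
    using r by (simp add: exp_add)
  also have "l + ln r = ln r / 2" by (simp add: l_def)
  also have "exp (ln r / 2) < 1" using r by simp
  finally have lr: "exp l * r < 1" .
  let ?\<tau> = "hitting_time X {0}"
  have pos: "0 \<le> ?\<tau> \<omega>" for \<omega>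
    unfolding hitting_time_def by (rule Inf_greatest) auto
  have "(\<integral>\<^sup>+\<omega>. ext_exp (ereal l * ?\<tau> \<omega>) \<partial>P x) \<le>
      (\<integral>\<^sup>+\<omega>. 1 + (\<Sum>i. ennreal (exp (l * real (Suc i))) * indicator {\<omega> \<in> space M. ?\<tau> \<omega> > ereal (real i)} \<omega>) \<partial>P x)"
  proof (rule nn_integral_mono_AE)
    show "AE \<omega> in P x. ext_exp (ereal l * ?\<tau> \<omega>) \<le>
        1 + (\<Sum>i. ennreal (exp (l * real (Suc i))) * indicator {\<omega> \<in> space M. ?\<tau> \<omega> > ereal (real i)} \<omega>)"
      using AE_hits_0[of x] AE_space
    proof eventually_elim
      case (elim \<omega>)
      then obtain s where s: "?\<tau> \<omega> = ereal s" "0 \<le> s"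
        using pos[of \<omega>] by (cases "?\<tau> \<omega>") auto
      show ?case
      proof (cases "s = 0")
        case True
        then show ?thesis using s by (simp add: ext_exp_def zero_ereal_def)
      next
        case False
        define j where "j = nat (\<lceil>s\<rceil> - 1)"
        have j: "real j < s" "s \<le> real (Suc j)"
          using False s(2) unfolding j_def by (simp_all, linarith+)
        have "ext_exp (ereal l * ?\<tau> \<omega>) = ennreal (exp (l * s))"
          by (simp add: s ext_exp_def)
        also have "\<dots> \<le> ennreal (exp (l * real (Suc j)))"
          using j l by (intro ennreal_leI) simp
        also have "\<dots> = (\<Sum>i\<in>{j}. ennreal (exp (l * real (Suc i))) * indicator {\<omega> \<in> space M. ?\<tau> \<omega> > ereal (real i)} \<omega>)"
          using j elim s by simp
        also have "\<dots> \<le> (\<Sum>i. ennreal (exp (l * real (Suc i))) * indicator {\<omega> \<in> space M. ?\<tau> \<omega> > ereal (real i)} \<omega>)"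
          by (rule sum_le_suminf) (auto intro: summableI)
        also have "\<dots> \<le> 1 + \<dots>" by simp
        finally show ?thesis .
      qed
    qed
  qed
  also have "\<dots> = 1 + (\<Sum>i. ennreal (exp (l * real (Suc i))) * emeasure (P x) {\<omega> \<in> space M. ?\<tau> \<omega> > ereal (real i)})"
  proof -
    have A: "{\<omega> \<in> space M. ?\<tau> \<omega> > ereal (real i)} \<in> events" for i
      unfolding sets_P by measurable
    then have meas: "(\<lambda>\<omega>. ennreal (exp (l * real (Suc i))) *
        indicator {\<omega> \<in> space M. ?\<tau> \<omega> > ereal (real i)} \<omega>) \<in> borel_measurable (P x)" for i
      by (intro borel_measurable_times_ennreal borel_measurable_indicator) simp_all
    then have "(\<lambda>\<omega>. \<Sum>i. ennreal (exp (l * real (Suc i))) *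
        indicator {\<omega> \<in> space M. ?\<tau> \<omega> > ereal (real i)} \<omega>) \<in> borel_measurable (P x)"
      by measurable
    then have "(\<integral>\<^sup>+\<omega>. 1 + (\<Sum>i. ennreal (exp (l * real (Suc i))) *
          indicator {\<omega> \<in> space M. ?\<tau> \<omega> > ereal (real i)} \<omega>) \<partial>P x) =
        (\<integral>\<^sup>+\<omega>. 1 \<partial>P x) + (\<integral>\<^sup>+\<omega>. (\<Sum>i. ennreal (exp (l * real (Suc i))) *
          indicator {\<omega> \<in> space M. ?\<tau> \<omega> > ereal (real i)} \<omega>) \<partial>P x)"
      by (intro nn_integral_add) auto
    also have "(\<integral>\<^sup>+\<omega>. 1 \<partial>P x) = 1"
      by (simp add: emeasure_space_1[unfolded space_P])
    also have "(\<integral>\<^sup>+\<omega>. (\<Sum>i. ennreal (exp (l * real (Suc i))) *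
          indicator {\<omega> \<in> space M. ?\<tau> \<omega> > ereal (real i)} \<omega>) \<partial>P x) =
        (\<Sum>i. \<integral>\<^sup>+\<omega>. ennreal (exp (l * real (Suc i))) *
          indicator {\<omega> \<in> space M. ?\<tau> \<omega> > ereal (real i)} \<omega> \<partial>P x)"
      by (rule nn_integral_suminf[OF meas])
    finally show ?thesis
      unfolding nn_integral_cmult_indicator[OF A] .
  qed
  also have "\<dots> = 1 + (\<Sum>i. ennreal (exp (l * real (Suc i)) * survival (real i) x))"
    by (simp add: survival_eq emeasure_eq_measure ennreal_mult)
  also have "\<dots> \<le> 1 + (\<Sum>i. ennreal (c * exp l * (exp l * r) ^ i))"
  proof (intro add_left_mono suminf_le summableI ennreal_leI)
    fix i
    have "exp (l * real (Suc i)) * survival (real i) x \<le> exp (l * real (Suc i)) * (c * r ^ i)"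
      by (intro mult_left_mono le) simp
    also have "\<dots> = c * exp l * (exp l * r) ^ i"
      by (simp add: exp_add distrib_left exp_of_nat_mult[symmetric] power_mult_distrib mult_ac)
    finally show "exp (l * real (Suc i)) * survival (real i) x \<le> c * exp l * (exp l * r) ^ i" .
  qed
  also have "\<dots> < \<infinity>"
  proof -
    have c: "0 \<le> c" using order_trans[OF survival_nonneg le[of 0]] by simp
    have "summable (\<lambda>i. c * exp l * (exp l * r) ^ i)"
      using lr r by (intro summable_mult summable_geometric) simp
    then have "(\<Sum>i. ennreal (c * exp l * (exp l * r) ^ i)) = ennreal (\<Sum>i. c * exp l * (exp l * r) ^ i)"
      using c r by (intro suminf_ennreal2) auto
    then show ?thesis by simp
  qed
  finally have "(\<integral>\<^sup>+\<omega>. ext_exp (ereal l * ?\<tau> \<omega>) \<partial>P x) < \<infinity>" .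
  then have "ereal l \<le> decay_parameter X P"
    unfolding decay_parameter_def using l x by (intro Sup_upper) auto
  with l show ?thesis
    by (meson ereal_less(2) less_le_trans)
qed

text \<open>Summing the invariance over the positive states gives survival probability
  \<open>exp (- L * t)\<close>, which cancels in the conditional law.\<close>

lemma quasi_stationary_if_invariant:
  assumes \<mu>0: "pmf \<mu> 0 = 0"
    and inv: "\<And>t y. 0 \<le> t \<Longrightarrow> 0 < y \<Longrightarrow> pmf (bind_pmf \<mu> (law t)) y = exp (- L * t) * pmf \<mu> y"
  shows "quasi_stationary X P \<mu>"
proof -
  have mass: "measure (bind_pmf \<mu> (law t)) {0<..} = exp (- L * t)" if t: "0 \<le> t" for t
  proof -
    have "measure \<mu> (UNIV - {0}) = 1"
      using measure_pmf.prob_compl[of "{0}" \<mu>] \<mu>0 by (simp add: measure_pmf_single)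
    moreover have "UNIV - {0 :: nat} = {0<..}" by auto
    ultimately have one: "emeasure \<mu> {0<..} = 1"
      by (simp add: measure_pmf.emeasure_eq_measure)
    have "emeasure (bind_pmf \<mu> (law t)) {0<..} =
        (\<integral>\<^sup>+y. ennreal (pmf (bind_pmf \<mu> (law t)) y) \<partial>count_space {0<..})"
      by (rule nn_integral_pmf[symmetric])
    also have "\<dots> = (\<integral>\<^sup>+y. ennreal (exp (- L * t)) * ennreal (pmf \<mu> y) \<partial>count_space {0<..})"
      using inv[OF t] by (intro nn_integral_cong) (simp add: ennreal_mult)
    also have "\<dots> = ennreal (exp (- L * t))"
      by (simp add: nn_integral_cmult nn_integral_pmf one)
    finally show ?thesis
      by (simp add: measure_pmf.emeasure_eq_measure del: emeasure_bind_pmf)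
  qed
  show ?thesis
    unfolding quasi_stationary_iff
  proof (intro conjI allI impI)
    fix y and t :: real assume t: "0 \<le> t"
    show "pmf \<mu> y = measure (bind_pmf \<mu> (law t)) ({y} \<inter> {0<..}) / measure (bind_pmf \<mu> (law t)) {0<..}"
    proof (cases "y = 0")
      case False
      then have "{y} \<inter> {0<..} = {y}" by auto
      then show ?thesis
        using inv[OF t] False by (simp add: mass[OF t] measure_pmf_single)
    qed (simp add: \<mu>0)
  qed (simp add: mass)
qed

theorem quasi_stationary_iff_decay_parameter_pos:
  "(\<exists>\<nu>. quasi_stationary X P \<nu>) \<longleftrightarrow> 0 < decay_parameter X P"
proof
  assume "\<exists>\<nu>. quasi_stationary X P \<nu>"
  then obtain \<nu> where pos: "\<And>t. 0 \<le> t \<Longrightarrow> 0 < measure (bind_pmf \<nu> (law t)) {0<..}"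
    and qs: "\<And>y t. 0 \<le> t \<Longrightarrow> pmf \<nu> y =
      measure (bind_pmf \<nu> (law t)) ({y} \<inter> {0<..}) / measure (bind_pmf \<nu> (law t)) {0<..}"
    unfolding quasi_stationary_iff by blast
  have qs': "pmf (bind_pmf \<nu> (law t)) y = measure (bind_pmf \<nu> (law t)) {0<..} * pmf \<nu> y"
    if "0 \<le> t" "0 < y" for t y
  proof -
    have "{y} \<inter> {0<..} = {y}" using that by auto
    then show ?thesis
      using qs[OF that(1), of y] pos[OF that(1)] by (simp add: measure_pmf_single)
  qed
  have \<nu>0: "pmf \<nu> 0 = 0" using qs[of 0 0] by simp
  show "0 < decay_parameter X P"
    by (rule survival_geometric_if_quasi_stationary[OF pos[OF zero_le_one] qs' \<nu>0 survival_tendsto_0])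
       (assumption | rule decay_parameter_pos_if_survival_geometric)+
next
  assume "0 < decay_parameter X P"
  then obtain l x c where l: "0 < l" "1 \<le> x" "\<And>t. 0 \<le> t \<Longrightarrow> survival t x \<le> c * exp (- l * t)"
    using survival_exponential_if_decay_parameter_pos by blast
  show "\<exists>\<nu>. quasi_stationary X P \<nu>"
  \<comment> \<open>The value 1/2 stands for any constant in \<open>(0, 1)\<close>: if the supremum
    of survival is below 1 at some positive time, submultiplicativity brings it below 1/2
    later.\<close>
  proof (cases "\<forall>i. \<exists>x. 1 / 2 < survival (real i) x")
    case True
    obtain \<mu> where "pmf \<mu> 0 = 0" "\<And>t y. 0 \<le> t \<Longrightarrow> 0 < y \<Longrightarrow>
        pmf (bind_pmf \<mu> (law t)) y = exp (- (l / 2) * t) * pmf \<mu> y"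
    proof (rule quasi_stationary_if_remote[OF _ _ l])
      show "\<exists>y. 1 / 2 < survival (real i) y" for i using True by blast
    qed (simp_all add: survival_mono law_irreducible)
    then have "quasi_stationary X P \<mu>" by (rule quasi_stationary_if_invariant)
    then show ?thesis ..
  next
    case False
    then obtain i where i: "\<And>x. survival (real i) x \<le> 1 / 2"
      by (auto simp: not_less)
    have "i \<noteq> 0"
    proof
      assume "i = 0"
      with i[of 1] show False by (simp add: survival_def K_0)
    qed
    \<comment> \<open>This rate turns the bound 1/2 at time \<open>i\<close> into
      \<open>exp (- l0 * i)\<close>, the form that \<open>survival_uniform_decay\<close>
      iterates.\<close>
    define l0 where "l0 = ln 2 / real i"
    have l0: "0 < l0" "exp (- l0 * real i) = 1 / 2"
      using \<open>i \<noteq> 0\<close> by (auto simp: l0_def exp_minus)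
    have decay: "survival t x \<le> exp (l0 * real i) * exp (- l0 * t)" if "0 \<le> t" for t x
    proof (rule survival_uniform_decay)
      show "survival (real i) x \<le> exp (- l0 * real i)" for x
        unfolding l0(2) by (rule i)
    qed (use l0(1) \<open>i \<noteq> 0\<close> that in simp_all)
    show ?thesis
    proof (rule quasi_stationary_if_entrance[OF _ _ l0(1) decay])
      show "\<exists>m. \<forall>x. measure (law 1 x) {m..} \<le> e" if "0 < e" for e
        by (rule law_1_tight[OF i that])
      fix L \<mu>
      assume "pmf \<mu> 0 = 0" "\<And>t y. 0 \<le> t \<Longrightarrow> 0 < y \<Longrightarrow>
        pmf (bind_pmf \<mu> (law t)) y = exp (- L * t) * pmf \<mu> y"
      then have "quasi_stationary X P \<mu>" by (rule quasi_stationary_if_invariant)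
      then show ?thesis ..
    qed (simp_all add: survival_mono)
  qed
qed

end

theorem corollary1p6:
  fixes M :: "'a measure"
    and X :: "real \<Rightarrow> 'a \<Rightarrow> nat option"
    and P :: "nat \<Rightarrow> 'a measure"
    and Q :: "nat \<Rightarrow> nat \<Rightarrow> real"
  assumes "downward_skip_free_chain M X P Q"
    and "\<And>x. \<P>(\<omega> in P x. hitting_time X {0} \<omega> < \<infinity>) = 1"
  shows "(\<exists>\<nu>. quasi_stationary X P \<nu>) \<longleftrightarrow> decay_parameter X P > 0"
proof -
  interpret downward_skip_free_chain M X P Q by fact
  interpret absorbed_chain M X P Q by unfold_locales fact
  show ?thesis by (rule quasi_stationary_iff_decay_parameter_pos)
qed

end
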